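(* Let $U(\vec{\theta})$ be a one-dimensional alternating-layered hardware efficient ansatz (HEA) of depth $D$ on $n$ qubits, let $|\psi\rangle$ be an $n$-qubit pure state, and let $O=\sum_{i}c_iP_i$ with $P_i$ Pauli operators and $c_i\in\mathbb{R}$. Let $f(\vec{\theta})=\mathrm{Tr}[U(\vec{\theta})|\psi\rangle\langle\psi|U^{\dagger}(\vec{\theta})O]$ and $f_{trv}=2^{-n}\mathrm{Tr}[O]$. For each $i$ let $\Lambda_i:=\operatorname{supp}(U^{\dagger}(\vec{\theta})P_iU(\vec{\theta}))$. Then $$|f(\vec{\theta})-f_{trv}|\le \sum_i |c_i|\,\mathcal{I}_{\Lambda_i}(\psi),$$ and moreover $\sum_i|c_i|\le (3n)^{\max_i|\operatorname{supp}(P_i)|}\|O\|_\infty$. Letting $\Lambda$ denote a largest of the sets $\Lambda_i$, its size satisfies $$|\Lambda|\le 2D\cdot \max_i|\operatorname{supp}(P_i)|.$$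
   Context: Qubits are arranged on a line with nearest-neighbour couplings. A one-dimensional alternating-layered HEA of depth $D$ is a circuit $U(\vec\theta)$ consisting of $D$ layers; in each layer two-qubit (parametrized) gates act on disjoint pairs of neighbouring qubits $(j,j+1)$, and the pairings alternate between consecutive layers in a brick-like pattern. Parametrized gates are of the form $e^{-i\theta_l H_l}V_l$ with $H_l$ traceless Pauli operators and $V_l$ fixed unitaries. The support $\operatorname{supp}(X)$ of an operator is the set of qubits on which it acts non-trivially. For a subset $\Lambda$ of qubits, $\psi_\Lambda=\mathrm{Tr}_{\bar\Lambda}[|\psi\rangle\langle\psi|]$ is the reduced state and $\mathcal{I}_{\Lambda}(\psi):=\left\|\psi_\Lambda-\frac{\mathbb{1}_\Lambda}{2^{|\Lambda|}}\right\|_1$ (trace norm). $\|\cdot\|_\infty$ is the operator norm.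
   Formalization: The Pauli operators P_i are assumed pairwise distinct (else O = X − X = 0 violates the bound on Σ|c_i|), the sum is finite and nonempty, and the depth satisfies D ≥ 1 (for D = 0 the bound |Λ| ≤ 2D·max|supp(P_i)| fails). *)

theory Defs
  imports Complex_Main
begin

text \<open>Computational basis configurations: a basis state of the qubits in a set S is a
  function nat => bool that is False outside S. Operators on the qubits S are
  complex-valued kernels indexed by such configurations (only values on cfgs S matter).\<close>

type_synonym cfg = "nat \<Rightarrow> bool"
type_synonym qop = "cfg \<Rightarrow> cfg \<Rightarrow> complex"
type_synonym qvec = "cfg \<Rightarrow> complex"

definition cfgs :: "nat set \<Rightarrow> cfg set" where
  "cfgs S = {a. \<forall>j. j \<notin> S \<longrightarrow> \<not> a j}"

definition ident :: "nat set \<Rightarrow> qop" where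
  "ident S a b = (if a = b \<and> a \<in> cfgs S then 1 else 0)"

definition mmult :: "nat set \<Rightarrow> qop \<Rightarrow> qop \<Rightarrow> qop" where
  "mmult S A B a b = (\<Sum>c\<in>cfgs S. A a c * B c b)"

definition adj :: "qop \<Rightarrow> qop" where
  "adj A a b = cnj (A b a)"

definition tr :: "nat set \<Rightarrow> qop \<Rightarrow> complex" where
  "tr S A = (\<Sum>a\<in>cfgs S. A a a)"

primrec mpow :: "nat set \<Rightarrow> qop \<Rightarrow> nat \<Rightarrow> qop" where
  "mpow S A 0 = ident S"
| "mpow S A (Suc k) = mmult S A (mpow S A k)"

definition mexp :: "nat set \<Rightarrow> qop \<Rightarrow> qop" where
  "mexp S A a b = (\<Sum>k. mpow S A k a b / of_nat (fact k))"

definition is_unitary :: "nat set \<Rightarrow> qop \<Rightarrow> bool" where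
  "is_unitary S U = (\<forall>a\<in>cfgs S. \<forall>b\<in>cfgs S.
      mmult S (adj U) U a b = ident S a b \<and> mmult S U (adj U) a b = ident S a b)"

definition applyv :: "nat set \<Rightarrow> qop \<Rightarrow> qvec \<Rightarrow> qvec" where
  "applyv S A v a = (\<Sum>b\<in>cfgs S. A a b * v b)"

definition vnorm :: "nat set \<Rightarrow> qvec \<Rightarrow> real" where
  "vnorm S v = sqrt (\<Sum>a\<in>cfgs S. (cmod (v a))\<^sup>2)"

definition vinner :: "nat set \<Rightarrow> qvec \<Rightarrow> qvec \<Rightarrow> complex" where
  "vinner S v w = (\<Sum>a\<in>cfgs S. cnj (v a) * w a)"

definition supported_on :: "nat set \<Rightarrow> qop \<Rightarrow> bool" where
  "supported_on S B = (\<forall>a b. B a b \<noteq> 0 \<longrightarrow> a \<in> cfgs S \<and> b \<in> cfgs S)"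

definition psd :: "nat set \<Rightarrow> qop \<Rightarrow> bool" where
  "psd S B = (supported_on S B \<and> (\<forall>a b. B a b = cnj (B b a)) \<and>
              (\<forall>v. Re (vinner S v (applyv S B v)) \<ge> 0))"

definition trace_norm :: "nat set \<Rightarrow> qop \<Rightarrow> real" where
  "trace_norm S A = Re (tr S (THE B. psd S B \<and>
      (\<forall>a\<in>cfgs S. \<forall>b\<in>cfgs S. mmult S B B a b = mmult S (adj A) A a b)))"

definition op_norm :: "nat set \<Rightarrow> qop \<Rightarrow> real" where
  "op_norm S A = (SUP v\<in>{v. vnorm S v \<le> 1}. vnorm S (applyv S A v))"

text \<open>Support of an n-qubit operator: qubits j<n on which it does not act as identity,
  i.e. X is not of the form I_j (tensor) Y.\<close>
definition acts_trivially_on :: "nat \<Rightarrow> nat \<Rightarrow> qop \<Rightarrow> bool" where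
  "acts_trivially_on n j X = (\<forall>a\<in>cfgs {..<n}. \<forall>b\<in>cfgs {..<n}.
      (a j \<noteq> b j \<longrightarrow> X a b = 0) \<and> X a b = X (a(j := \<not> a j)) (b(j := \<not> b j)))"

definition supp :: "nat \<Rightarrow> qop \<Rightarrow> nat set" where
  "supp n X = {j\<in>{..<n}. \<not> acts_trivially_on n j X}"

text \<open>Single-qubit Paulis: 0 = I, 1 = X, 2 = Y, 3 = Z (basis |0> = False, |1> = True).\<close>
definition pauli1 :: "nat \<Rightarrow> bool \<Rightarrow> bool \<Rightarrow> complex" where
  "pauli1 k x y =
    (if k = 0 then (if x = y then 1 else 0)
     else if k = 1 then (if x \<noteq> y then 1 else 0)
     else if k = 2 then (if x = y then 0 else if x then \<i> else - \<i>)
     else (if x = y then (if x then -1 else 1) else 0))"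

definition is_pauli_label :: "nat \<Rightarrow> (nat \<Rightarrow> nat) \<Rightarrow> bool" where
  "is_pauli_label n p = ((\<forall>j. p j < 4) \<and> (\<forall>j. n \<le> j \<longrightarrow> p j = 0))"

definition pauli_string :: "nat \<Rightarrow> (nat \<Rightarrow> nat) \<Rightarrow> qop" where
  "pauli_string n p a b = (\<Prod>j<n. pauli1 (p j) (a j) (b j))"

definition proj :: "qvec \<Rightarrow> qop" where
  "proj \<psi> a b = \<psi> a * cnj (\<psi> b)"

definition joinc :: "cfg \<Rightarrow> cfg \<Rightarrow> cfg" where
  "joinc a c = (\<lambda>j. a j \<or> c j)"

definition reduced_state :: "nat \<Rightarrow> nat set \<Rightarrow> qvec \<Rightarrow> qop" where
  "reduced_state n \<Lambda> \<psi> a b =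
     (if a \<in> cfgs \<Lambda> \<and> b \<in> cfgs \<Lambda>
      then (\<Sum>c\<in>cfgs ({..<n} - \<Lambda>). proj \<psi> (joinc a c) (joinc b c)) else 0)"

definition info :: "nat \<Rightarrow> nat set \<Rightarrow> qvec \<Rightarrow> real" where
  "info n \<Lambda> \<psi> = trace_norm \<Lambda>
      (\<lambda>a b. reduced_state n \<Lambda> \<psi> a b - ident \<Lambda> a b / 2 ^ card \<Lambda>)"

text \<open>One-dimensional alternating-layered HEA. Layer l (l = 0..D-1) applies a two-qubit
  gate on each pair (j, j+1), j+1 < n, with j + l + s even (brick pattern, s fixes the
  offset of the first layer). Gate = exp(-i theta H) V, H a traceless Pauli string
  supported on {j,j+1}, V a fixed unitary supported on {j,j+1}. U = L_{D-1} ... L_0.\<close>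
definition hea_pairs :: "nat \<Rightarrow> nat \<Rightarrow> nat \<Rightarrow> nat list" where
  "hea_pairs n s l = filter (\<lambda>j. even (j + l + s)) [0..<n - 1]"

definition hea_gate :: "nat \<Rightarrow> (nat \<Rightarrow> nat \<Rightarrow> real) \<Rightarrow> (nat \<Rightarrow> nat \<Rightarrow> qop) \<Rightarrow>
    (nat \<Rightarrow> nat \<Rightarrow> qop) \<Rightarrow> nat \<Rightarrow> nat \<Rightarrow> qop" where
  "hea_gate n \<theta> H V l j =
     mmult {..<n} (mexp {..<n} (\<lambda>a b. - \<i> * of_real (\<theta> l j) * H l j a b)) (V l j)"

definition hea_layer :: "nat \<Rightarrow> (nat \<Rightarrow> nat \<Rightarrow> real) \<Rightarrow> (nat \<Rightarrow> nat \<Rightarrow> qop) \<Rightarrow>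
    (nat \<Rightarrow> nat \<Rightarrow> qop) \<Rightarrow> nat \<Rightarrow> nat \<Rightarrow> qop" where
  "hea_layer n \<theta> H V s l =
     foldr (\<lambda>j M. mmult {..<n} (hea_gate n \<theta> H V l j) M) (hea_pairs n s l) (ident {..<n})"

primrec hea_unitary :: "nat \<Rightarrow> (nat \<Rightarrow> nat \<Rightarrow> real) \<Rightarrow> (nat \<Rightarrow> nat \<Rightarrow> qop) \<Rightarrow>
    (nat \<Rightarrow> nat \<Rightarrow> qop) \<Rightarrow> nat \<Rightarrow> nat \<Rightarrow> qop" where
  "hea_unitary n \<theta> H V s 0 = ident {..<n}"
| "hea_unitary n \<theta> H V s (Suc d) =
     mmult {..<n} (hea_layer n \<theta> H V s d) (hea_unitary n \<theta> H V s d)"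

definition valid_hea :: "nat \<Rightarrow> nat \<Rightarrow> nat \<Rightarrow> (nat \<Rightarrow> nat \<Rightarrow> qop) \<Rightarrow> (nat \<Rightarrow> nat \<Rightarrow> qop) \<Rightarrow> bool" where
  "valid_hea n D s H V = (\<forall>l<D. \<forall>j\<in>set (hea_pairs n s l).
      (\<exists>p. is_pauli_label n p \<and> H l j = pauli_string n p) \<and>
      supp n (H l j) \<subseteq> {j, Suc j} \<and> tr {..<n} (H l j) = 0 \<and>
      is_unitary {..<n} (V l j) \<and> supp n (V l j) \<subseteq> {j, Suc j})"

end

theory Submission
  imports Defs
    "HOL-Computational_Algebra.Fundamental_Theorem_Algebra"
    "HOL-Analysis.Convex"
    "HOL-Analysis.Complex_Transcendental"
begin

text \<open>In the Heisenberg picture \<open>f - f\<^sub>t\<^sub>r\<^sub>v\<close> is the \<open>c\<^sub>i\<close>-weighted sum of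
  \<open>Tr (|\<psi>><\<psi>| X\<^sub>i) - 2\<^sup>-\<^sup>n Tr X\<^sub>i\<close> with \<open>X\<^sub>i = U\<^sup>* P\<^sub>i U\<close>. As \<open>X\<^sub>i\<close> acts as a unitary on its
  support \<open>\<Lambda>\<^sub>i\<close> only, each term equals \<open>Tr ((\<psi>\<^sub>\<Lambda> - 1 / 2\<^sup>|\<^sup>\<Lambda>\<^sup>|) X\<^sub>i)\<close> on \<open>\<Lambda>\<^sub>i\<close>, which duality bounds
  by the trace norm; an orthonormal eigenbasis computes the trace norm and yields the duality.
  For the coefficients, orthogonality of the Pauli strings gives
  \<open>\<Sum> c\<^sub>i\<^sup>2 = 2\<^sup>-\<^sup>n Tr O\<^sup>2 \<le> \<parallel>O\<parallel>\<^sup>2\<close>, and Cauchy-Schwarz brings in the square root of the number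
  of strings of weight at most \<open>k\<close>. Finally, a gate disjoint from the support of an operator
  commutes with it and cancels, so a layer only enlarges the support to a union of bricks; since the
  bricks alternate, a single qubit spreads to 2 sites and then to one more on each side per layer.\<close>

section \<open>Spectral theorem for Hermitian kernels\<close>

text \<open>\<open>trace_norm\<close> is the trace of a positive square root picked by
  \<open>THE\<close>, so it has a computable value only once that root is known to exist and to be
  unique; this calls for a complete orthonormal eigenbasis. The basis is grown one vector at a time
  inside the orthogonal complement of the previous ones, and dimension is counted by traces of
  projections. Kernels are functions on all configurations although only entries over
  \<open>cfgs S\<close> have meaning, so many operator identities hold only entrywise there; the
  genuine equality that \<open>THE\<close> demands comes from requiring \<open>psd\<close> kernels
  to vanish elsewhere. A configuration of \<Lambda> is also one of the whole chain, with False on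
  the remaining qubits. An operator with support \<Lambda> thus serves, by the same kernel, as its
  own restriction to \<Lambda>. The constant \<open>2 D\<close> is \<open>2 + 2 (D - 1)\<close> per
  site: the last layer, which acts first on \<open>P\<^sub>i\<close>, turns a site into a brick, and
  only the other \<open>D - 1\<close> layers widen it by two.\<close>

lemma linear_dependence:
  fixes f :: "'i \<Rightarrow> 'a \<Rightarrow> 'k::field"
  assumes "finite K" "finite I" "card K < card I"
  shows "\<exists>x. (\<exists>i\<in>I. x i \<noteq> 0) \<and> (\<forall>a\<in>K. (\<Sum>i\<in>I. x i * f i a) = 0)"
  using assms
proof (induction K arbitrary: I f rule: finite_induct)
  case empty
  then have "I \<noteq> {}" by auto
  then show ?case by (intro exI[of _ "\<lambda>_. 1"]) auto
next
  case (insert a K)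
  show ?case
  proof (cases "\<forall>i\<in>I. f i a = 0")
    case True
    have "card K < card I" using insert by simp
    from insert.IH[OF insert.prems(1) this, of f] True show ?thesis by auto
  next
    case False
    then obtain k where k: "k \<in> I" "f k a \<noteq> 0" by auto
    define J where "J = I - {k}"
    have J: "finite J" "card K < card J" using insert k by (auto simp: J_def)
    \<comment> \<open>Gaussian elimination with pivot \<open>f k a\<close>: every \<open>g i\<close>
      vanishes at \<open>a\<close>, so a relation among the \<open>g i\<close> on \<open>K\<close>
      becomes one among the \<open>f i\<close> once the coefficient of \<open>k\<close> is chosen to
      cancel the value at \<open>a\<close>.\<close>
    define g where "g i b = f i b - f i a / f k a * f k b" for i b
    from insert.IH[OF J, of g] obtain x where x: "\<exists>i\<in>J. x i \<noteq> 0"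
      "\<And>b. b \<in> K \<Longrightarrow> (\<Sum>i\<in>J. x i * g i b) = 0" by blast
    define y where "y = x(k := - (\<Sum>i\<in>J. x i * f i a) / f k a)"
    have sumI: "(\<Sum>i\<in>I. y i * f i b)
        = (\<Sum>i\<in>J. x i * f i b) - (\<Sum>i\<in>J. x i * f i a) / f k a * f k b" for b
    proof -
      have "(\<Sum>i\<in>I. y i * f i b) = y k * f k b + (\<Sum>i\<in>J. y i * f i b)"
        unfolding J_def by (rule sum.remove) (use insert k in auto)
      moreover have "(\<Sum>i\<in>J. y i * f i b) = (\<Sum>i\<in>J. x i * f i b)"
        by (rule sum.cong) (auto simp: J_def y_def)
      ultimately show ?thesis by (simp add: y_def)
    qed
    have "(\<Sum>i\<in>J. x i * g i b)
        = (\<Sum>i\<in>J. x i * f i b) - (\<Sum>i\<in>J. x i * f i a) / f k a * f k b" for b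
      by (simp add: g_def algebra_simps sum_subtractf sum_distrib_left sum_divide_distrib)
    then have "(\<Sum>i\<in>I. y i * f i b) = 0" if "b \<in> K" for b
      using sumI[of b] x(2)[OF that] by simp
    moreover have "(\<Sum>i\<in>I. y i * f i a) = 0" using k by (simp add: sumI)
    moreover have "\<exists>i\<in>I. y i \<noteq> 0" using x(1) by (auto simp: y_def J_def)
    ultimately show ?thesis by (intro exI[of _ y]) auto
  qed
qed

lemma applyv_add_scale:
  "applyv S A (\<lambda>b. u b + x * w b) a = applyv S A u a + x * applyv S A w a"
  by (simp add: applyv_def algebra_simps sum.distrib sum_distrib_left)

lemma vinner_add_scale_right:
  "vinner S v (\<lambda>b. u b + x * w b) = vinner S v u + x * vinner S v w"
  by (simp add: vinner_def algebra_simps sum.distrib sum_distrib_left)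

lemma vinner_scale_right: "vinner S v (\<lambda>b. x * w b) = x * vinner S v w"
  by (simp add: vinner_def algebra_simps sum_distrib_left)

lemma vinner_scale_left: "vinner S (\<lambda>b. x * v b) w = cnj x * vinner S v w"
  by (simp add: vinner_def algebra_simps sum_distrib_left)

lemma vinner_commute: "vinner S v w = cnj (vinner S w v)"
  by (simp add: vinner_def mult.commute)

lemma vinner_self: "vinner S v v = of_real (\<Sum>a\<in>cfgs S. (cmod (v a))\<^sup>2)"
  by (simp add: vinner_def complex_norm_square[symmetric] mult.commute)

lemma vinner_self_eq_0_iff:
  assumes "finite (cfgs S)"
  shows "vinner S v v = 0 \<longleftrightarrow> (\<forall>a\<in>cfgs S. v a = 0)"
  by (simp add: vinner_self sum_nonneg_eq_0_iff[OF assms] del: of_real_sum)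

lemma vinner_applyv_hermitian:
  assumes "\<And>a b. A a b = cnj (A b a)"
  shows "vinner S v (applyv S A w) = vinner S (applyv S A v) w"
proof -
  have "vinner S v (applyv S A w) = (\<Sum>a\<in>cfgs S. \<Sum>b\<in>cfgs S. cnj (v a) * (A a b * w b))"
    by (simp add: vinner_def applyv_def sum_distrib_left)
  also have "\<dots> = (\<Sum>b\<in>cfgs S. \<Sum>a\<in>cfgs S. cnj (v a) * (A a b * w b))"
    by (rule sum.swap)
  also have "\<dots> = (\<Sum>b\<in>cfgs S. \<Sum>a\<in>cfgs S. cnj (A b a * v a) * w b)"
    by (intro sum.cong refl) (subst (1) assms, simp add: mult_ac)
  also have "\<dots> = vinner S (applyv S A v) w"
    by (simp add: vinner_def applyv_def sum_distrib_right)
  finally show ?thesis .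
qed

lemma applyv_supported:
  assumes "supported_on S A" "a \<notin> cfgs S"
  shows "applyv S A v a = 0"
  unfolding applyv_def using assms by (intro sum.neutral) (auto simp: supported_on_def)

lemma applyv_mmult: "applyv S (mmult S A B) v = applyv S A (applyv S B v)"
proof
  fix a
  have "applyv S (mmult S A B) v a = (\<Sum>c\<in>cfgs S. \<Sum>b\<in>cfgs S. A a b * B b c * v c)"
    by (simp add: applyv_def mmult_def sum_distrib_right)
  also have "\<dots> = (\<Sum>b\<in>cfgs S. \<Sum>c\<in>cfgs S. A a b * B b c * v c)"
    by (rule sum.swap)
  also have "\<dots> = applyv S A (applyv S B v) a"
    by (simp add: applyv_def sum_distrib_left mult.assoc)
  finally show "applyv S (mmult S A B) v a = applyv S A (applyv S B v) a" .
qed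

text \<open>Split off a root \<open>\<mu>\<close> of \<open>p\<close>: either \<open>(A - \<mu>) u = 0\<close> or this vector is annihilated by
  a polynomial of smaller degree.\<close>

lemma eigenvector_of_annihilating_poly:
  assumes W: "\<And>u v x. u \<in> W \<Longrightarrow> v \<in> W \<Longrightarrow> (\<lambda>a. u a + x * v a) \<in> W"
    and inv: "\<And>u. u \<in> W \<Longrightarrow> applyv S A u \<in> W"
    and "p \<noteq> 0" "u \<in> W" "u \<noteq> (\<lambda>_. 0)"
    and "\<And>a. (\<Sum>i\<le>degree p. coeff p i * (applyv S A ^^ i) u a) = 0"
  shows "\<exists>w\<in>W. \<exists>\<mu>. w \<noteq> (\<lambda>_. 0) \<and> applyv S A w = (\<lambda>a. \<mu> * w a)"
  using assms(3-)
proof (induction "degree p" arbitrary: p u rule: less_induct)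
  case less
  show ?case
  proof (cases "degree p = 0")
    case True
    then have "coeff p 0 \<noteq> 0" using less.prems(1) leading_coeff_0_iff by metis
    moreover have "coeff p 0 * u a = 0" for a using less.prems(4)[of a] True by simp
    ultimately have "u = (\<lambda>_. 0)" by auto
    then show ?thesis using less.prems(3) by simp
  next
    case False
    then have "\<not> constant (poly p)" by (simp add: constant_degree)
    then obtain \<mu> where "poly p \<mu> = 0" using fundamental_theorem_of_algebra by blast
    then obtain q where q: "p = [:-\<mu>, 1:] * q" by (auto simp: poly_eq_0_iff_dvd)
    then have q0: "q \<noteq> 0" using less.prems(1) by auto
    have deg: "degree p = Suc (degree q)" unfolding q using q0 by (subst degree_mult_eq) auto
    define w where "w = (\<lambda>a. applyv S A u a + (-\<mu>) * u a)"
    have wW: "w \<in> W" unfolding w_def using W inv less.prems(2) by blast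
    show ?thesis
    proof (cases "w = (\<lambda>_. 0)")
      case True
      have "applyv S A u = (\<lambda>a. \<mu> * u a)"
      proof
        fix a show "applyv S A u a = \<mu> * u a" using fun_cong[OF True, of a] by (simp add: w_def)
      qed
      then show ?thesis using less.prems by blast
    next
      case False
      define t where "t i = (applyv S A ^^ i) u" for i
      have tS: "applyv S A (t i) = t (Suc i)" for i by (simp add: t_def)
      have Aw: "(applyv S A ^^ i) w = (\<lambda>a. t (Suc i) a + (-\<mu>) * t i a)" for i
      proof (induction i)
        case 0 show ?case by (simp add: w_def t_def)
      next
        case (Suc i)
        have "(applyv S A ^^ Suc i) w = applyv S A (\<lambda>a. t (Suc i) a + (-\<mu>) * t i a)"
          using Suc by simp
        also have "\<dots> = (\<lambda>a. t (Suc (Suc i)) a + (-\<mu>) * t (Suc i) a)"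
          by (rule ext, subst applyv_add_scale) (simp only: tS)
        finally show ?case .
      qed
      have c0: "coeff p 0 = - \<mu> * coeff q 0" by (simp add: q)
      have cS: "coeff p (Suc i) = coeff q i - \<mu> * coeff q (Suc i)" for i by (simp add: q)
      have "(\<Sum>i\<le>degree q. coeff q i * (applyv S A ^^ i) w a) = 0" for a
      proof -
        \<comment> \<open>\<open>coeff q\<close> vanishes at \<open>Suc (degree q)\<close>; padding
          by this zero term gives the sum the range to which the index shift applies.\<close>
        have z: "(\<Sum>i\<le>degree q. coeff q i * t i a) = (\<Sum>i\<le>Suc (degree q). coeff q i * t i a)"
          by (simp add: coeff_eq_0)
        have "0 = (\<Sum>i\<le>Suc (degree q). coeff p i * t i a)"
          using less.prems(4)[of a] deg by (simp add: t_def)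
        also have "\<dots> = coeff p 0 * t 0 a + (\<Sum>i\<le>degree q. coeff p (Suc i) * t (Suc i) a)"
          by (rule sum.atMost_Suc_shift)
        also have "\<dots> = (\<Sum>i\<le>degree q. coeff q i * t (Suc i) a)
            - \<mu> * (coeff q 0 * t 0 a + (\<Sum>i\<le>degree q. coeff q (Suc i) * t (Suc i) a))"
          by (simp add: c0 cS algebra_simps sum_subtractf sum_distrib_left)
        also have "coeff q 0 * t 0 a + (\<Sum>i\<le>degree q. coeff q (Suc i) * t (Suc i) a)
            = (\<Sum>i\<le>degree q. coeff q i * t i a)"
          unfolding z by (rule sum.atMost_Suc_shift[symmetric])
        finally show ?thesis
          by (simp add: Aw algebra_simps sum_subtractf sum_distrib_left)
      qed
      then show ?thesis using less.hyps[of q w] deg q0 wW False by simp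
    qed
  qed
qed

text \<open>With \<open>d = card (cfgs S)\<close>, the \<open>d + 1\<close> iterates of
  \<open>u\<close> under \<open>A\<close> are linearly dependent, and a dependence is a nonzero
  polynomial in \<open>A\<close> annihilating \<open>u\<close>. This takes the place of a
  characteristic polynomial, and everything built from the iterates stays in
  \<open>W\<close>.\<close>

lemma eigenvector_in_invariant_subspace:
  assumes fin: "finite (cfgs S)"
    and W: "\<And>u v x. u \<in> W \<Longrightarrow> v \<in> W \<Longrightarrow> (\<lambda>a. u a + x * v a) \<in> W"
    and inv: "\<And>u. u \<in> W \<Longrightarrow> applyv S A u \<in> W"
    and off: "\<And>u a. u \<in> W \<Longrightarrow> a \<notin> cfgs S \<Longrightarrow> u a = 0"
    and u: "u \<in> W" "u \<noteq> (\<lambda>_. 0)"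
  shows "\<exists>w\<in>W. \<exists>\<mu>. w \<noteq> (\<lambda>_. 0) \<and> applyv S A w = (\<lambda>a. \<mu> * w a)"
proof -
  let ?I = "{..card (cfgs S)}"
  have "card (cfgs S) < card ?I" by simp
  from linear_dependence[OF fin _ this, of "\<lambda>i. (applyv S A ^^ i) u"] obtain x where
    x: "\<exists>i\<in>?I. x i \<noteq> 0" "\<And>a. a \<in> cfgs S \<Longrightarrow> (\<Sum>i\<in>?I. x i * (applyv S A ^^ i) u a) = 0"
    by auto
  define p where "p = (\<Sum>i\<in>?I. monom (x i) i)"
  have cp: "coeff p j = (if j \<in> ?I then x j else 0)" for j
    by (simp add: p_def coeff_sum)
  have "p \<noteq> 0" using x(1) cp by (metis coeff_0)
  have "(\<Sum>i\<le>degree p. coeff p i * (applyv S A ^^ i) u a) = 0" for a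
  proof -
    have "degree p \<le> card (cfgs S)" by (rule degree_le) (simp add: cp)
    then have "(\<Sum>i\<le>degree p. coeff p i * (applyv S A ^^ i) u a)
        = (\<Sum>i\<in>?I. coeff p i * (applyv S A ^^ i) u a)"
      by (intro sum.mono_neutral_left) (auto intro: coeff_eq_0)
    also have "\<dots> = (\<Sum>i\<in>?I. x i * (applyv S A ^^ i) u a)"
      by (rule sum.cong) (auto simp: cp)
    also have "\<dots> = 0"
    proof (cases "a \<in> cfgs S")
      case False
      have "(applyv S A ^^ i) u \<in> W" for i by (induction i) (use u inv in auto)
      then have "(applyv S A ^^ i) u a = 0" for i using off False by blast
      then show ?thesis by simp
    qed (use x in auto)
    finally show ?thesis .
  qed
  with \<open>p \<noteq> 0\<close> u show ?thesis using eigenvector_of_annihilating_poly[OF W inv] by blast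
qed

text \<open>A partial eigenbasis, so that it can be extended by induction on \<open>m\<close>.
  Eigenvalues are real by type, and the vectors vanish off \<open>cfgs S\<close>, where inner
  products see nothing.\<close>

definition eigensystem :: "nat set \<Rightarrow> qop \<Rightarrow> nat \<Rightarrow> (nat \<Rightarrow> qvec) \<Rightarrow> (nat \<Rightarrow> real) \<Rightarrow> bool" where
  "eigensystem S A m v ev = (\<forall>i<m. (\<forall>a. a \<notin> cfgs S \<longrightarrow> v i a = 0) \<and>
      applyv S A (v i) = (\<lambda>a. of_real (ev i) * v i a) \<and>
      (\<forall>j<m. vinner S (v i) (v j) = (if i = j then 1 else 0)))"

text \<open>For an orthonormal system, the part of the basis vector at \<open>a\<close> orthogonal
  to the first \<open>m\<close> vectors. A nonzero defect starts the search for a further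
  eigenvector; the vanishing of all defects is the completeness relation.\<close>

definition defect :: "nat \<Rightarrow> (nat \<Rightarrow> qvec) \<Rightarrow> cfg \<Rightarrow> qvec" where
  "defect m v a = (\<lambda>b. (if b = a then 1 else 0) - (\<Sum>i<m. cnj (v i a) * v i b))"

lemma defect_orthogonal:
  assumes fin: "finite (cfgs S)" and E: "eigensystem S A m v ev" and a: "a \<in> cfgs S" and j: "j < m"
  shows "vinner S (v j) (defect m v a) = 0"
proof -
  have "vinner S (v j) (defect m v a)
      = (\<Sum>b\<in>cfgs S. cnj (v j b) * (if b = a then 1 else 0))
        - (\<Sum>b\<in>cfgs S. \<Sum>i<m. cnj (v j b) * (cnj (v i a) * v i b))"
    by (simp add: vinner_def defect_def right_diff_distrib sum_subtractf sum_distrib_left)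
  also have "(\<Sum>b\<in>cfgs S. cnj (v j b) * (if b = a then 1 else 0)) = cnj (v j a)"
    using fin a by (simp add: if_distrib cong: if_cong)
  also have "(\<Sum>b\<in>cfgs S. \<Sum>i<m. cnj (v j b) * (cnj (v i a) * v i b))
      = (\<Sum>i<m. cnj (v i a) * vinner S (v j) (v i))"
    by (subst sum.swap) (simp add: vinner_def sum_distrib_left mult_ac)
  also have "\<dots> = (\<Sum>i<m. if i = j then cnj (v i a) else 0)"
    using E j by (intro sum.cong) (auto simp: eigensystem_def)
  also have "\<dots> = cnj (v j a)" using j by simp
  finally show ?thesis by simp
qed

lemma defect_norm:
  assumes fin: "finite (cfgs S)" and E: "eigensystem S A m v ev" and a: "a \<in> cfgs S"
  shows "vinner S (defect m v a) (defect m v a) = 1 - of_real (\<Sum>i<m. (cmod (v i a))\<^sup>2)"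
proof -
  let ?r = "defect m v a"
  have "vinner S ?r ?r = (\<Sum>b\<in>cfgs S. cnj (?r b) * (if b = a then 1 else 0))
      - (\<Sum>b\<in>cfgs S. \<Sum>i<m. cnj (?r b) * (cnj (v i a) * v i b))"
    by (subst (2) defect_def)
      (simp add: vinner_def right_diff_distrib sum_subtractf sum_distrib_left)
  also have "(\<Sum>b\<in>cfgs S. cnj (?r b) * (if b = a then 1 else 0)) = cnj (?r a)"
    using fin a by (simp add: if_distrib cong: if_cong)
  also have "(\<Sum>b\<in>cfgs S. \<Sum>i<m. cnj (?r b) * (cnj (v i a) * v i b))
      = (\<Sum>i<m. cnj (v i a) * cnj (vinner S (v i) ?r))"
    by (subst sum.swap) (simp add: vinner_def sum_distrib_left mult_ac)
  also have "\<dots> = 0" using defect_orthogonal[OF fin E a] by simp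
  finally show ?thesis
    by (simp add: defect_def complex_norm_square[symmetric] mult.commute)
qed

text \<open>The left-hand side is the trace of the projection onto the orthogonal complement, hence
  its dimension; this is the only dimension count that the extension and the completeness
  need.\<close>

lemma sum_defect_norm:
  assumes fin: "finite (cfgs S)" and E: "eigensystem S A m v ev"
  shows "(\<Sum>a\<in>cfgs S. vinner S (defect m v a) (defect m v a))
    = of_nat (card (cfgs S)) - of_nat m"
proof -
  have "(\<Sum>a\<in>cfgs S. vinner S (defect m v a) (defect m v a))
      = (\<Sum>a\<in>cfgs S. 1 - of_real (\<Sum>i<m. (cmod (v i a))\<^sup>2))"
    by (rule sum.cong) (auto simp: defect_norm[OF assms] simp del: of_real_sum)
  also have "\<dots> = of_nat (card (cfgs S)) - (\<Sum>i<m. of_real (\<Sum>a\<in>cfgs S. (cmod (v i a))\<^sup>2))"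
    by (simp add: sum_subtractf, subst sum.swap, simp)
  also have "(\<Sum>i<m. of_real (\<Sum>a\<in>cfgs S. (cmod (v i a))\<^sup>2)) = (\<Sum>i<m. (1::complex))"
    using E by (intro sum.cong refl) (simp add: eigensystem_def del: of_real_sum flip: vinner_self)
  finally show ?thesis by simp
qed

text \<open>The orthogonal complement \<open>W\<close> is invariant because \<open>A\<close> is
  Hermitian, and it is not zero because the defects have total squared norm
  \<open>card (cfgs S) - m > 0\<close>. Any eigenvector in it, once normalized, extends the
  system.\<close>

lemma eigensystem_extend:
  assumes fin: "finite (cfgs S)" and A: "supported_on S A" and herm: "\<And>a b. A a b = cnj (A b a)"
    and E: "eigensystem S A m v ev" and m: "m < card (cfgs S)"
  shows "\<exists>w \<mu>. eigensystem S A (Suc m) (v(m := w)) (ev(m := \<mu>))"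
proof -
  define W where "W = {u. (\<forall>a. a \<notin> cfgs S \<longrightarrow> u a = 0) \<and> (\<forall>i<m. vinner S (v i) u = 0)}"
  have W: "(\<lambda>a. u a + x * v a) \<in> W" if "u \<in> W" "v \<in> W" for u v x
    using that by (auto simp: W_def vinner_add_scale_right)
  have inv: "applyv S A u \<in> W" if "u \<in> W" for u
  proof -
    have "vinner S (v i) (applyv S A u) = 0" if i: "i < m" for i
    proof -
      have "vinner S (v i) (applyv S A u) = vinner S (applyv S A (v i)) u"
        by (rule vinner_applyv_hermitian[OF herm])
      also have "\<dots> = 0" using E i \<open>u \<in> W\<close>
        by (simp add: eigensystem_def vinner_scale_left W_def)
      finally show ?thesis .
    qed
    then show ?thesis using applyv_supported[OF A] by (auto simp: W_def)
  qed
  have off: "u a = 0" if "u \<in> W" "a \<notin> cfgs S" for u a using that by (simp add: W_def)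
  have "\<exists>a\<in>cfgs S. vinner S (defect m v a) (defect m v a) \<noteq> 0"
  proof (rule ccontr)
    assume "\<not> ?thesis"
    then have "(\<Sum>a\<in>cfgs S. vinner S (defect m v a) (defect m v a)) = 0" by simp
    then show False using m by (simp add: sum_defect_norm[OF fin E])
  qed
  then obtain a where a: "a \<in> cfgs S" "vinner S (defect m v a) (defect m v a) \<noteq> 0" by blast
  have d1: "defect m v a \<in> W"
    using a E defect_orthogonal[OF fin E a(1)] by (auto simp: W_def defect_def eigensystem_def)
  have d2: "defect m v a \<noteq> (\<lambda>_. 0)" using a(2) by (auto simp: vinner_def)
  have "\<exists>w\<in>W. \<exists>\<mu>. w \<noteq> (\<lambda>_. 0) \<and> applyv S A w = (\<lambda>a. \<mu> * w a)"
    by (rule eigenvector_in_invariant_subspace[where W=W and S=S and A=A, OF fin]) (fact W inv off d1 d2)+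
  then obtain w \<mu> where w: "w \<in> W" "w \<noteq> (\<lambda>_. 0)" and Aw: "applyv S A w = (\<lambda>a. \<mu> * w a)"
    by blast
  define r where "r = (\<Sum>a\<in>cfgs S. (cmod (w a))\<^sup>2)"
  have ww: "vinner S w w = of_real r" by (simp add: vinner_self r_def)
  have "vinner S w w \<noteq> 0" using w by (auto simp: vinner_self_eq_0_iff[OF fin] W_def fun_eq_iff)
  then have "r \<noteq> 0" using ww by auto
  then have r: "r > 0" by (simp add: r_def less_le sum_nonneg)
  \<comment> \<open>Moving \<open>A\<close> to either side of the inner product of \<open>w\<close>
    with \<open>A w\<close> shows that the eigenvalue is real.\<close>
  have "\<mu> * of_real r = vinner S w (applyv S A w)"
    by (simp add: Aw vinner_scale_right ww)
  also have "\<dots> = cnj \<mu> * of_real r"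
    by (subst vinner_applyv_hermitian[OF herm]) (simp add: Aw vinner_scale_left ww)
  finally have "cnj \<mu> = \<mu>" using r by simp
  then have \<mu>: "of_real (Re \<mu>) = \<mu>" by (metis Reals_cnj_iff of_real_Re)
  define w' where "w' = (\<lambda>a. of_real (1 / sqrt r) * w a)"
  have "vinner S (v i) w' = 0" if "i < m" for i
    using w that unfolding w'_def vinner_scale_right by (simp add: W_def)
  then have w'W: "w' \<in> W" using w by (auto simp: W_def w'_def)
  have Aw': "applyv S A w' = (\<lambda>a. of_real (Re \<mu>) * w' a)"
  proof
    fix a
    have "applyv S A w' a = of_real (1 / sqrt r) * applyv S A w a"
      unfolding w'_def applyv_def by (simp add: sum_distrib_left mult_ac)
    then show "applyv S A w' a = of_real (Re \<mu>) * w' a" by (simp add: Aw \<mu> w'_def)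
  qed
  have w'w': "vinner S w' w' = 1"
  proof -
    have "vinner S w' w' = of_real (1 / sqrt r * (1 / sqrt r) * r)"
      unfolding w'_def vinner_scale_left vinner_scale_right ww
      by (simp only: complex_cnj_complex_of_real of_real_mult mult.assoc)
    also have "1 / sqrt r * (1 / sqrt r) * r = 1" using r by simp
    finally show ?thesis by simp
  qed
  have vw: "vinner S (v i) w' = 0" "vinner S w' (v i) = 0" if "i < m" for i
    using w'W that vinner_commute[of S w' "v i"] by (auto simp: W_def)
  have "eigensystem S A (Suc m) (v(m := w')) (ev(m := Re \<mu>))"
    using E w'W Aw' w'w' vw unfolding eigensystem_def
    by (auto simp: less_Suc_eq W_def)
  then show ?thesis by blast
qed

text \<open>At full length the squared norms of the defects sum to zero, so each defect vanishes,
  which is the completeness relation read entry by entry.\<close>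

lemma hermitian_spectral:
  assumes fin: "finite (cfgs S)" and A: "supported_on S A" and herm: "\<And>a b. A a b = cnj (A b a)"
  obtains v ev where "eigensystem S A (card (cfgs S)) v ev"
    "\<And>a b. a \<in> cfgs S \<Longrightarrow> b \<in> cfgs S \<Longrightarrow>
       (\<Sum>i<card (cfgs S). v i a * cnj (v i b)) = (if a = b then 1 else 0)"
proof -
  have "m \<le> card (cfgs S) \<Longrightarrow> \<exists>v ev. eigensystem S A m v ev" for m
  proof (induction m)
    case 0 show ?case by (auto simp: eigensystem_def)
  next
    case (Suc m)
    then obtain v ev where "eigensystem S A m v ev" by auto
    from eigensystem_extend[OF assms this] Suc show ?case by auto
  qed
  then obtain v ev where E: "eigensystem S A (card (cfgs S)) v ev" by blast
  let ?r = "\<lambda>b. defect (card (cfgs S)) v b"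
  have "(\<Sum>b\<in>cfgs S. vinner S (?r b) (?r b)) = 0" by (simp add: sum_defect_norm[OF fin E])
  then have "of_real (\<Sum>b\<in>cfgs S. \<Sum>a\<in>cfgs S. (cmod (?r b a))\<^sup>2) = (0::complex)"
    by (simp add: vinner_self)
  then have "(\<Sum>b\<in>cfgs S. \<Sum>a\<in>cfgs S. (cmod (?r b a))\<^sup>2) = 0" using of_real_eq_0_iff by blast
  then have "\<forall>b\<in>cfgs S. (\<Sum>a\<in>cfgs S. (cmod (?r b a))\<^sup>2) = 0"
    by (subst (asm) sum_nonneg_eq_0_iff) (use fin in \<open>auto intro: sum_nonneg\<close>)
  then have "?r b a = 0" if "a \<in> cfgs S" "b \<in> cfgs S" for a b
    using that fin by (simp add: sum_nonneg_eq_0_iff)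
  then have "(\<Sum>i<card (cfgs S). v i a * cnj (v i b)) = (if a = b then 1 else 0)"
    if "a \<in> cfgs S" "b \<in> cfgs S" for a b
    using that by (simp add: defect_def mult.commute)
  with E show ?thesis using that by blast
qed

section \<open>Trace norm\<close>

lemma cfgs_eq_image: "cfgs S = (\<lambda>T j. j \<in> T) ` Pow S"
proof
  show "cfgs S \<subseteq> (\<lambda>T j. j \<in> T) ` Pow S"
  proof
    fix a assume "a \<in> cfgs S"
    then have "a = (\<lambda>j. j \<in> {j. a j})" "{j. a j} \<in> Pow S" by (auto simp: cfgs_def)
    then show "a \<in> (\<lambda>T j. j \<in> T) ` Pow S" by blast
  qed
qed (auto simp: cfgs_def)

lemma finite_cfgs: "finite S \<Longrightarrow> finite (cfgs S)"
  by (simp add: cfgs_eq_image)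

lemma card_cfgs: "finite S \<Longrightarrow> card (cfgs S) = 2 ^ card S"
  unfolding cfgs_eq_image by (subst card_image) (auto simp: inj_on_def fun_eq_iff card_Pow)

lemma applyv_scale: "applyv S A (\<lambda>b. x * w b) = (\<lambda>a. x * applyv S A w a)"
  by (simp add: fun_eq_iff applyv_def sum_distrib_left mult_ac)

lemma vinner_cong:
  "(\<And>a. a \<in> cfgs S \<Longrightarrow> v a = v' a) \<Longrightarrow> (\<And>a. a \<in> cfgs S \<Longrightarrow> w a = w' a)
    \<Longrightarrow> vinner S v w = vinner S v' w'"
  by (auto simp: vinner_def intro!: sum.cong)

lemma applyv_cong:
  "(\<And>b. b \<in> cfgs S \<Longrightarrow> A a b = B a b) \<Longrightarrow> (\<And>b. b \<in> cfgs S \<Longrightarrow> v b = w b)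
    \<Longrightarrow> applyv S A v a = applyv S B w a"
  by (auto simp: applyv_def intro!: sum.cong)

lemma applyv_ident:
  assumes "finite (cfgs S)" "a \<in> cfgs S"
  shows "applyv S (ident S) v a = v a"
proof -
  have "applyv S (ident S) v a = (\<Sum>b\<in>cfgs S. if a = b then v b else 0)"
    unfolding applyv_def ident_def by (rule sum.cong) auto
  then show ?thesis using assms by simp
qed

lemma vinner_applyv_adj: "vinner S v (applyv S A w) = vinner S (applyv S (adj A) v) w"
proof -
  have "vinner S v (applyv S A w) = (\<Sum>a\<in>cfgs S. \<Sum>b\<in>cfgs S. cnj (v a) * (A a b * w b))"
    by (simp add: vinner_def applyv_def sum_distrib_left)
  also have "\<dots> = (\<Sum>b\<in>cfgs S. \<Sum>a\<in>cfgs S. cnj (v a) * (A a b * w b))"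
    by (rule sum.swap)
  also have "\<dots> = vinner S (applyv S (adj A) v) w"
    by (simp add: vinner_def applyv_def adj_def sum_distrib_right sum_distrib_left mult_ac)
  finally show ?thesis .
qed

lemma adj_adj: "adj (adj A) = A"
  by (simp add: fun_eq_iff adj_def)

lemma vinner_isometry:
  assumes fin: "finite (cfgs S)"
    and iso: "\<And>a b. a \<in> cfgs S \<Longrightarrow> b \<in> cfgs S \<Longrightarrow> mmult S (adj X) X a b = ident S a b"
  shows "vinner S (applyv S X v) (applyv S X w) = vinner S v w"
proof -
  have "vinner S (applyv S X v) (applyv S X w) = vinner S v (applyv S (mmult S (adj X) X) w)"
    by (simp add: vinner_applyv_adj[of S v] applyv_mmult adj_adj vinner_applyv_adj[of S _ "adj X"])
  also have "\<dots> = vinner S v w"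
  proof (rule vinner_cong)
    fix a assume a: "a \<in> cfgs S"
    have "applyv S (mmult S (adj X) X) w a = applyv S (ident S) w a"
      by (rule applyv_cong) (use iso a in auto)
    then show "applyv S (mmult S (adj X) X) w a = w a" using applyv_ident[OF fin a] by simp
  qed simp
  finally show ?thesis .
qed

text \<open>The arithmetic-geometric mean inequality applied entrywise: for unit vectors it gives
  the same bound 1 as Cauchy-Schwarz, without square roots.\<close>

lemma cmod_vinner_le:
  "cmod (vinner S v w) \<le> ((\<Sum>a\<in>cfgs S. (cmod (v a))\<^sup>2) + (\<Sum>a\<in>cfgs S. (cmod (w a))\<^sup>2)) / 2"
proof -
  have "cmod (vinner S v w) \<le> (\<Sum>a\<in>cfgs S. cmod (v a) * cmod (w a))"
    unfolding vinner_def by (rule order_trans[OF norm_sum]) (simp add: norm_mult)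
  also have "\<dots> \<le> (\<Sum>a\<in>cfgs S. ((cmod (v a))\<^sup>2 + (cmod (w a))\<^sup>2) / 2)"
  proof (rule sum_mono)
    fix a
    have "0 \<le> (cmod (v a) - cmod (w a))\<^sup>2" by simp
    then show "cmod (v a) * cmod (w a) \<le> ((cmod (v a))\<^sup>2 + (cmod (w a))\<^sup>2) / 2"
      by (simp add: power2_diff)
  qed
  finally show ?thesis by (simp add: sum.distrib sum_divide_distrib[symmetric])
qed

section \<open>Absolute value of a Hermitian kernel and trace duality\<close>

locale eigenbasis =
  fixes S :: "nat set" and A :: qop and v :: "nat \<Rightarrow> qvec" and ev :: "nat \<Rightarrow> real"
  assumes fin: "finite (cfgs S)"
    and herm: "A a b = cnj (A b a)"
    and sys: "eigensystem S A (card (cfgs S)) v ev"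
    and complete: "a \<in> cfgs S \<Longrightarrow> b \<in> cfgs S \<Longrightarrow>
      (\<Sum>i<card (cfgs S). v i a * cnj (v i b)) = (if a = b then 1 else 0)"
begin

abbreviation "d \<equiv> card (cfgs S)"

lemma eigen: "i < d \<Longrightarrow> applyv S A (v i) = (\<lambda>a. of_real (ev i) * v i a)"
  and orthonormal: "i < d \<Longrightarrow> j < d \<Longrightarrow> vinner S (v i) (v j) = (if i = j then 1 else 0)"
  and off: "i < d \<Longrightarrow> a \<notin> cfgs S \<Longrightarrow> v i a = 0"
  using sys by (auto simp: eigensystem_def)

lemma norm_v: "i < d \<Longrightarrow> (\<Sum>a\<in>cfgs S. (cmod (v i a))\<^sup>2) = 1"
  using orthonormal[of i i] unfolding vinner_self by (metis of_real_eq_1_iff)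

text \<open>Completeness inserted as a resolution of the identity to the right of \<open>X\<close>;
  a kernel is thereby determined by its action on the eigenbasis.\<close>

lemma expansion:
  assumes "b \<in> cfgs S"
  shows "X a b = (\<Sum>i<d. applyv S X (v i) a * cnj (v i b))"
proof -
  have "(\<Sum>i<d. applyv S X (v i) a * cnj (v i b))
      = (\<Sum>c\<in>cfgs S. \<Sum>i<d. X a c * (v i c * cnj (v i b)))"
    by (subst sum.swap) (simp add: applyv_def sum_distrib_right mult.assoc)
  also have "\<dots> = (\<Sum>c\<in>cfgs S. X a c * (if c = b then 1 else 0))"
    using complete assms by (simp flip: sum_distrib_left)
  also have "\<dots> = X a b" using fin assms by (simp add: if_distrib cong: if_cong)
  finally show ?thesis by simp
qed

lemma eq_if_eq_on_basis:
  assumes "\<And>i a. i < d \<Longrightarrow> a \<in> cfgs S \<Longrightarrow> applyv S X (v i) a = applyv S Y (v i) a"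
    and "a \<in> cfgs S" "b \<in> cfgs S"
  shows "X a b = Y a b"
  unfolding expansion[OF assms(3), of X] expansion[OF assms(3), of Y] using assms by simp

text \<open>The operator absolute value of \<open>A\<close> in spectral form, the candidate for the
  positive square root of \<open>adj A\<close> times \<open>A\<close>.\<close>

definition absop :: qop where
  "absop a b = (\<Sum>i<d. of_real \<bar>ev i\<bar> * v i a * cnj (v i b))"

lemma applyv_absop: "applyv S absop u a = (\<Sum>i<d. of_real \<bar>ev i\<bar> * v i a * vinner S (v i) u)"
  unfolding applyv_def absop_def vinner_def sum_distrib_left sum_distrib_right
  by (subst sum.swap) (simp add: mult_ac)

lemma absop_eigen:
  assumes "i < d"
  shows "applyv S absop (v i) = (\<lambda>a. of_real \<bar>ev i\<bar> * v i a)"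
proof
  fix a
  have "applyv S absop (v i) a = (\<Sum>j<d. if j = i then of_real \<bar>ev j\<bar> * v j a else 0)"
    unfolding applyv_absop by (rule sum.cong) (use assms orthonormal in auto)
  then show "applyv S absop (v i) a = of_real \<bar>ev i\<bar> * v i a" using assms by simp
qed

lemma psd_absop: "psd S absop"
  unfolding psd_def
proof (intro conjI allI)
  show "supported_on S absop" unfolding supported_on_def
  proof (intro allI impI, rule ccontr)
    fix a b assume nz: "absop a b \<noteq> 0" and "\<not> (a \<in> cfgs S \<and> b \<in> cfgs S)"
    then have "absop a b = 0" unfolding absop_def using off by (intro sum.neutral) auto
    with nz show False by simp
  qed
  show "absop a b = cnj (absop b a)" for a b by (simp add: absop_def mult_ac)
  fix u
  have "vinner S u (applyv S absop u)
      = (\<Sum>a\<in>cfgs S. \<Sum>i<d. of_real \<bar>ev i\<bar> * (cnj (u a) * v i a) * vinner S (v i) u)"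
    by (simp add: vinner_def[of S u] applyv_absop sum_distrib_left mult_ac)
  also have "\<dots> = (\<Sum>i<d. of_real \<bar>ev i\<bar> * vinner S u (v i) * vinner S (v i) u)"
    by (subst sum.swap) (simp add: vinner_def[of S u] sum_distrib_left sum_distrib_right)
  also have "\<dots> = (\<Sum>i<d. of_real (\<bar>ev i\<bar> * (cmod (vinner S u (v i)))\<^sup>2))"
  proof (rule sum.cong[OF refl])
    fix i
    have "vinner S u (v i) * vinner S (v i) u = of_real ((cmod (vinner S u (v i)))\<^sup>2)"
      using vinner_commute[of S "v i" u] complex_norm_square by simp
    then show "of_real \<bar>ev i\<bar> * vinner S u (v i) * vinner S (v i) u
      = of_real (\<bar>ev i\<bar> * (cmod (vinner S u (v i)))\<^sup>2)" by (simp add: mult.assoc)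
  qed
  finally show "Re (vinner S u (applyv S absop u)) \<ge> 0" by (simp add: sum_nonneg)
qed

lemma adj_A: "adj A = A"
  by (intro ext, unfold adj_def, rule herm[symmetric])

lemma square_eigen:
  "i < d \<Longrightarrow> applyv S (mmult S (adj A) A) (v i) = (\<lambda>a. of_real ((ev i)\<^sup>2) * v i a)"
  by (simp add: applyv_mmult adj_A eigen applyv_scale power2_eq_square mult.assoc)

lemma absop_square:
  assumes "a \<in> cfgs S" "b \<in> cfgs S"
  shows "mmult S absop absop a b = mmult S (adj A) A a b"
proof (rule eq_if_eq_on_basis[where X="mmult S absop absop" and Y="mmult S (adj A) A", OF _ assms])
  fix i c assume i: "i < d"
  have "of_real \<bar>ev i\<bar> * of_real \<bar>ev i\<bar> = (of_real ((ev i)\<^sup>2) :: complex)"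
    unfolding of_real_mult[symmetric] by (simp add: power2_eq_square)
  then show "applyv S (mmult S absop absop) (v i) c = applyv S (mmult S (adj A) A) (v i) c"
    unfolding square_eigen[OF i] using i
    by (simp add: applyv_mmult absop_eigen applyv_scale del: of_real_power flip: mult.assoc)
qed

text \<open>For a positive square root \<open>C\<close> of \<open>A\<^sup>2\<close>, the vector \<open>w = C v\<^sub>i - |\<lambda>\<^sub>i| v\<^sub>i\<close> satisfies
  \<open>C w = - |\<lambda>\<^sub>i| w\<close>, which positivity only allows if \<open>w = 0\<close> or \<open>\<lambda>\<^sub>i = 0\<close>.\<close>

lemma psd_root_eigen:
  assumes C: "psd S C"
    and sq: "\<And>a b. a \<in> cfgs S \<Longrightarrow> b \<in> cfgs S \<Longrightarrow> mmult S C C a b = mmult S (adj A) A a b"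
    and i: "i < d" and a: "a \<in> cfgs S"
  shows "applyv S C (v i) a = of_real \<bar>ev i\<bar> * v i a"
proof -
  have Ch: "\<And>a b. C a b = cnj (C b a)" and pos: "\<And>u. Re (vinner S u (applyv S C u)) \<ge> 0"
    using C unfolding psd_def by blast+
  have CC: "applyv S C (applyv S C (v i)) a = of_real ((ev i)\<^sup>2) * v i a" if "a \<in> cfgs S" for a
  proof -
    have "applyv S C (applyv S C (v i)) a = applyv S (mmult S (adj A) A) (v i) a"
      unfolding applyv_mmult[symmetric] by (rule applyv_cong) (use sq that in auto)
    then show ?thesis by (simp add: square_eigen[OF i])
  qed
  show ?thesis
  proof (cases "ev i = 0")
    case True
    \<comment> \<open>For a zero eigenvalue positivity says nothing about \<open>w\<close>; instead
      the squared norm of \<open>C v\<^sub>i\<close> is the inner product of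
      \<open>v\<^sub>i\<close> with \<open>C\<^sup>2 v\<^sub>i = 0\<close>.\<close>
    let ?u = "applyv S C (v i)"
    have "vinner S ?u ?u = vinner S (v i) (applyv S C ?u)"
      by (rule vinner_applyv_hermitian[OF Ch, symmetric])
    also have "\<dots> = vinner S (v i) (\<lambda>_. 0)"
      by (rule vinner_cong) (simp_all add: CC True)
    finally have "vinner S ?u ?u = 0" by (simp add: vinner_def)
    then show ?thesis using a True by (simp add: vinner_self_eq_0_iff[OF fin])
  next
    case False
    define w where "w = (\<lambda>a. applyv S C (v i) a + (- of_real \<bar>ev i\<bar>) * v i a)"
    have Cw: "applyv S C w a = (- of_real \<bar>ev i\<bar>) * w a" if "a \<in> cfgs S" for a
    proof -
      have "applyv S C w a
          = applyv S C (applyv S C (v i)) a + (- of_real \<bar>ev i\<bar>) * applyv S C (v i) a"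
        unfolding w_def by (rule applyv_add_scale)
      moreover have "of_real ((ev i)\<^sup>2) = of_real \<bar>ev i\<bar> * (of_real \<bar>ev i\<bar> :: complex)"
        by (simp flip: of_real_mult add: power2_eq_square)
      ultimately show ?thesis using that by (simp add: CC w_def algebra_simps)
    qed
    have "vinner S w (applyv S C w) = (- of_real \<bar>ev i\<bar>) * vinner S w w"
      unfolding vinner_scale_right[symmetric] by (rule vinner_cong) (simp_all add: Cw)
    then have "Re (vinner S w (applyv S C w)) = - (\<bar>ev i\<bar> * (\<Sum>a\<in>cfgs S. (cmod (w a))\<^sup>2))"
      unfolding vinner_self by (simp del: of_real_sum)
    then have "\<bar>ev i\<bar> * (\<Sum>a\<in>cfgs S. (cmod (w a))\<^sup>2) \<le> 0" using pos[of w] by linarith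
    then have "(\<Sum>a\<in>cfgs S. (cmod (w a))\<^sup>2) \<le> 0" using False by (simp add: mult_le_0_iff)
    then have "(\<Sum>a\<in>cfgs S. (cmod (w a))\<^sup>2) = 0" by (simp add: antisym sum_nonneg)
    then have "w a = 0" using a by (simp add: sum_nonneg_eq_0_iff[OF fin])
    then show ?thesis by (simp add: w_def)
  qed
qed

text \<open>\<open>THE\<close> needs equality of functions. On \<open>cfgs S\<close> it follows from
  equal action on the eigenbasis, elsewhere from \<open>supported_on\<close>, which is part of
  \<open>psd\<close>.\<close>

lemma psd_root_unique:
  assumes C: "psd S C"
    and sq: "\<forall>a\<in>cfgs S. \<forall>b\<in>cfgs S. mmult S C C a b = mmult S (adj A) A a b"
  shows "C = absop"
proof (intro ext)
  fix a b
  show "C a b = absop a b"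
  proof (cases "a \<in> cfgs S \<and> b \<in> cfgs S")
    case True
    then show ?thesis
    proof (intro eq_if_eq_on_basis[where X=C and Y=absop])
      fix i a assume i: "i < d" and a: "a \<in> cfgs S"
      show "applyv S C (v i) a = applyv S absop (v i) a"
        unfolding absop_eigen[OF i] by (rule psd_root_eigen[OF C _ i a]) (use sq in blast)
    qed auto
  next
    case False
    moreover have "supported_on S C" "supported_on S absop"
      using C psd_absop by (simp_all add: psd_def)
    ultimately have "C a b = 0" "absop a b = 0"
      unfolding supported_on_def by blast+
    then show ?thesis by simp
  qed
qed

lemma trace_norm_eq: "trace_norm S A = (\<Sum>i<d. \<bar>ev i\<bar>)"
proof -
  have "(THE B. psd S B \<and>
      (\<forall>a\<in>cfgs S. \<forall>b\<in>cfgs S. mmult S B B a b = mmult S (adj A) A a b)) = absop"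
    by (rule the_equality) (use psd_absop absop_square psd_root_unique in blast)+
  moreover have "tr S absop = (\<Sum>i<d. of_real \<bar>ev i\<bar> * vinner S (v i) (v i))"
    unfolding tr_def absop_def vinner_def sum_distrib_left
    by (subst sum.swap) (simp add: mult_ac)
  ultimately show ?thesis by (simp add: trace_norm_def orthonormal)
qed

text \<open>In the eigenbasis the trace is the sum of \<open>ev i\<close> times the diagonal matrix
  elements of \<open>X\<close>. These have modulus at most 1 because \<open>X\<close> maps unit
  vectors to unit vectors.\<close>

lemma trace_duality:
  assumes iso: "\<And>a b. a \<in> cfgs S \<Longrightarrow> b \<in> cfgs S \<Longrightarrow> mmult S (adj X) X a b = ident S a b"
  shows "cmod (tr S (mmult S A X)) \<le> trace_norm S A"
proof -
  have "tr S (mmult S A X) = (\<Sum>a\<in>cfgs S. \<Sum>b\<in>cfgs S. \<Sum>i<d. of_real (ev i) * (cnj (v i b) * (X b a * v i a)))"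
    unfolding tr_def mmult_def
    by (intro sum.cong refl, subst expansion)
      (auto simp: eigen sum_distrib_right sum_distrib_left mult_ac)
  also have "\<dots> = (\<Sum>i<d. \<Sum>b\<in>cfgs S. \<Sum>a\<in>cfgs S. of_real (ev i) * (cnj (v i b) * (X b a * v i a)))"
    by (subst sum.swap) (subst (2) sum.swap, rule sum.swap[THEN trans], rule refl)
  also have "\<dots> = (\<Sum>i<d. of_real (ev i) * vinner S (v i) (applyv S X (v i)))"
    by (simp add: vinner_def applyv_def sum_distrib_left)
  finally have *: "tr S (mmult S A X) = (\<Sum>i<d. of_real (ev i) * vinner S (v i) (applyv S X (v i)))" .
  have le: "cmod (vinner S (v i) (applyv S X (v i))) \<le> 1" if i: "i < d" for i
  proof -
    have "vinner S (applyv S X (v i)) (applyv S X (v i)) = 1"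
      using vinner_isometry[OF fin iso] orthonormal i by simp
    then have "(\<Sum>a\<in>cfgs S. (cmod (applyv S X (v i) a))\<^sup>2) = 1"
      unfolding vinner_self by (metis of_real_eq_1_iff)
    then show ?thesis
      using cmod_vinner_le[of S "v i" "applyv S X (v i)"] norm_v[OF i] by simp
  qed
  have "cmod (tr S (mmult S A X)) \<le> (\<Sum>i<d. \<bar>ev i\<bar> * cmod (vinner S (v i) (applyv S X (v i))))"
    unfolding * by (rule order_trans[OF norm_sum]) (simp add: norm_mult)
  also have "\<dots> \<le> (\<Sum>i<d. \<bar>ev i\<bar>)"
    by (rule sum_mono) (use le in \<open>auto intro: mult_left_le\<close>)
  finally show ?thesis by (simp add: trace_norm_eq)
qed

end

lemma cmod_tr_mmult_le_trace_norm:
  assumes "finite S" "supported_on S A" "\<And>a b. A a b = cnj (A b a)"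
    and "\<And>a b. a \<in> cfgs S \<Longrightarrow> b \<in> cfgs S \<Longrightarrow> mmult S (adj X) X a b = ident S a b"
  shows "cmod (tr S (mmult S A X)) \<le> trace_norm S A"
proof -
  have fin: "finite (cfgs S)" using assms(1) by (rule finite_cfgs)
  obtain v ev where E: "eigensystem S A (card (cfgs S)) v ev"
    and c: "\<And>a b. a \<in> cfgs S \<Longrightarrow> b \<in> cfgs S \<Longrightarrow>
       (\<Sum>i<card (cfgs S). v i a * cnj (v i b)) = (if a = b then 1 else 0)"
    using hermitian_spectral[OF fin assms(2,3)] by blast
  interpret eigenbasis S A v ev
    by unfold_locales (fact fin assms(3) E c)+
  show ?thesis using assms(4) by (rule trace_duality)
qed

section \<open>Supports and light cones\<close>

text \<open>Equality as operators on the qubits in \<open>S\<close>. Laws such as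
  \<open>ident S\<close> being a unit hold only up to this relation, since kernels may take any
  value off \<open>cfgs S\<close>.\<close>

definition opeq :: "nat set \<Rightarrow> qop \<Rightarrow> qop \<Rightarrow> bool" where
  "opeq S A B \<longleftrightarrow> (\<forall>a\<in>cfgs S. \<forall>b\<in>cfgs S. A a b = B a b)"

lemma opeq_refl [simp]: "opeq S A A"
  and opeq_sym: "opeq S A B \<Longrightarrow> opeq S B A"
  and opeq_trans: "opeq S A B \<Longrightarrow> opeq S B C \<Longrightarrow> opeq S A C"
  by (simp_all add: opeq_def)

lemma opeq_mmult: "opeq S A A' \<Longrightarrow> opeq S B B' \<Longrightarrow> opeq S (mmult S A B) (mmult S A' B')"
  by (simp add: opeq_def mmult_def)

lemma opeq_adj: "opeq S A B \<Longrightarrow> opeq S (adj A) (adj B)"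
  by (simp add: opeq_def adj_def)

lemma mmult_assoc: "mmult S (mmult S A B) C = mmult S A (mmult S B C)"
proof (intro ext)
  fix a b
  have "mmult S (mmult S A B) C a b = (\<Sum>d\<in>cfgs S. \<Sum>c\<in>cfgs S. A a c * B c d * C d b)"
    by (simp add: mmult_def sum_distrib_right)
  also have "\<dots> = (\<Sum>c\<in>cfgs S. \<Sum>d\<in>cfgs S. A a c * B c d * C d b)"
    by (rule sum.swap)
  also have "\<dots> = mmult S A (mmult S B C) a b"
    by (simp add: mmult_def sum_distrib_left mult.assoc)
  finally show "mmult S (mmult S A B) C a b = mmult S A (mmult S B C) a b" .
qed

lemma adj_mmult: "adj (mmult S A B) = mmult S (adj B) (adj A)"
  by (simp add: fun_eq_iff adj_def mmult_def mult.commute)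

lemma opeq_ident_mmult:
  assumes "finite S"
  shows "opeq S (mmult S (ident S) A) A"
  unfolding opeq_def
proof (intro ballI)
  fix a b assume "a \<in> cfgs S" "b \<in> cfgs S"
  have "mmult S (ident S) A a b = (\<Sum>c\<in>cfgs S. if a = c then A c b else 0)"
    unfolding mmult_def ident_def by (rule sum.cong) auto
  then show "mmult S (ident S) A a b = A a b"
    using finite_cfgs[OF assms] \<open>a \<in> cfgs S\<close> by simp
qed

lemma opeq_mmult_ident:
  assumes "finite S"
  shows "opeq S (mmult S A (ident S)) A"
  unfolding opeq_def
proof (intro ballI)
  fix a b assume "a \<in> cfgs S" "b \<in> cfgs S"
  have "mmult S A (ident S) a b = (\<Sum>c\<in>cfgs S. if c = b then A a c else 0)"
    unfolding mmult_def ident_def by (rule sum.cong) auto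
  then show "mmult S A (ident S) a b = A a b"
    using finite_cfgs[OF assms] \<open>b \<in> cfgs S\<close> by simp
qed

lemma tr_opeq: "opeq S A B \<Longrightarrow> tr S A = tr S B"
  by (simp add: opeq_def tr_def)

lemma tr_mmult_commute: "tr S (mmult S A B) = tr S (mmult S B A)"
  unfolding tr_def mmult_def by (subst sum.swap) (simp add: mult.commute)

lemma is_unitary_iff:
  "is_unitary S U \<longleftrightarrow> opeq S (mmult S (adj U) U) (ident S) \<and> opeq S (mmult S U (adj U)) (ident S)"
  by (auto simp: is_unitary_def opeq_def)

lemma is_unitary_opeq:
  assumes "opeq S U V" "is_unitary S U"
  shows "is_unitary S V"
proof -
  have VU: "opeq S V U" using assms(1) by (rule opeq_sym)
  show ?thesis
    using assms(2) opeq_trans[OF opeq_mmult[OF opeq_adj[OF VU] VU]]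
      opeq_trans[OF opeq_mmult[OF VU opeq_adj[OF VU]]]
    by (simp add: is_unitary_iff)
qed

text \<open>Kept free of \<open>adj\<close> so that one statement yields both halves of unitarity of
  a product, with the factors taken in either order.\<close>

lemma opeq_mmult_cancel:
  assumes "finite S" "opeq S (mmult S A A') (ident S)" "opeq S (mmult S B B') (ident S)"
  shows "opeq S (mmult S (mmult S A B) (mmult S B' A')) (ident S)"
proof -
  have "opeq S (mmult S (mmult S B B') A') A'"
    by (rule opeq_trans[OF opeq_mmult[OF assms(3) opeq_refl] opeq_ident_mmult[OF assms(1)]])
  then have "opeq S (mmult S A (mmult S (mmult S B B') A')) (ident S)"
    by (rule opeq_trans[OF opeq_mmult[OF opeq_refl] assms(2)])
  then show ?thesis by (simp add: mmult_assoc)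
qed

lemma is_unitary_mmult:
  assumes "finite S" "is_unitary S U" "is_unitary S V"
  shows "is_unitary S (mmult S U V)"
  using assms(2,3) opeq_mmult_cancel[OF assms(1)] by (simp add: is_unitary_iff adj_mmult)

lemma adj_ident: "adj (ident S) = ident S"
  unfolding adj_def ident_def by (intro ext) auto

lemma is_unitary_ident: "finite S \<Longrightarrow> is_unitary S (ident S)"
  by (simp add: is_unitary_iff adj_ident opeq_ident_mmult)

section \<open>Operators acting trivially on a site\<close>

abbreviation flip_at :: "nat \<Rightarrow> cfg \<Rightarrow> cfg" where
  "flip_at j a \<equiv> a(j := \<not> a j)"

lemma flip_at_cfgs: "j \<in> S \<Longrightarrow> flip_at j a \<in> cfgs S \<longleftrightarrow> a \<in> cfgs S"
  by (auto simp: cfgs_def)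

lemma acts_trivially_onI:
  assumes "\<And>a b. a \<in> cfgs {..<n} \<Longrightarrow> b \<in> cfgs {..<n} \<Longrightarrow> a j \<noteq> b j \<Longrightarrow> X a b = 0"
    and "\<And>a b. a \<in> cfgs {..<n} \<Longrightarrow> b \<in> cfgs {..<n} \<Longrightarrow> X (flip_at j a) (flip_at j b) = X a b"
  shows "acts_trivially_on n j X"
  unfolding acts_trivially_on_def
proof (intro ballI conjI impI)
  fix a b assume ab: "a \<in> cfgs {..<n}" "b \<in> cfgs {..<n}"
  show "X a b = X (flip_at j a) (flip_at j b)" using assms(2)[OF ab] by (rule sym)
  show "X a b = 0" if "a j \<noteq> b j" using ab that by (rule assms(1))
qed

lemma trivial_eq_0:
  assumes "acts_trivially_on n j X" "a \<in> cfgs {..<n}" "b \<in> cfgs {..<n}" "a j \<noteq> b j"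
  shows "X a b = 0"
proof -
  have "(a j \<noteq> b j \<longrightarrow> X a b = 0) \<and> X a b = X (flip_at j a) (flip_at j b)"
    by (rule bspec[OF bspec[OF assms(1)[unfolded acts_trivially_on_def] assms(2)] assms(3)])
  then show ?thesis using assms(4) by (elim conjE) (rule mp)
qed

lemma trivial_flip:
  assumes "acts_trivially_on n j X" "a \<in> cfgs {..<n}" "b \<in> cfgs {..<n}"
  shows "X (flip_at j a) (flip_at j b) = X a b"
proof -
  have "(a j \<noteq> b j \<longrightarrow> X a b = 0) \<and> X a b = X (flip_at j a) (flip_at j b)"
    by (rule bspec[OF bspec[OF assms(1)[unfolded acts_trivially_on_def] assms(2)] assms(3)])
  then show ?thesis by (elim conjE) (rule sym)
qed

lemma acts_trivially_on_opeq:
  assumes eq: "opeq {..<n} X Y" and X: "acts_trivially_on n j X" and j: "j < n"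
  shows "acts_trivially_on n j Y"
proof (rule acts_trivially_onI)
  have XY: "Y a b = X a b" if "a \<in> cfgs {..<n}" "b \<in> cfgs {..<n}" for a b
    using eq that by (simp add: opeq_def)
  fix a b assume ab: "a \<in> cfgs {..<n}" "b \<in> cfgs {..<n}"
  show "Y a b = 0" if "a j \<noteq> b j" using XY[OF ab] trivial_eq_0[OF X ab that] by simp
  show "Y (flip_at j a) (flip_at j b) = Y a b"
    using XY[OF ab] XY[of "flip_at j a" "flip_at j b"] trivial_flip[OF X ab] ab j
    by (simp add: flip_at_cfgs)
qed

lemma flip_at_eq_iff: "flip_at j a = flip_at j b \<longleftrightarrow> a = b"
proof
  assume "flip_at j a = flip_at j b"
  then have "flip_at j (flip_at j a) = flip_at j (flip_at j b)" by simp
  then show "a = b" by simp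
qed simp

lemma acts_trivially_on_ident: "j < n \<Longrightarrow> acts_trivially_on n j (ident {..<n})"
  by (rule acts_trivially_onI) (auto simp: ident_def flip_at_cfgs flip_at_eq_iff simp del: fun_upd_apply)

lemma acts_trivially_on_adj: "acts_trivially_on n j X \<Longrightarrow> acts_trivially_on n j (adj X)"
  using trivial_eq_0[of n j X] trivial_flip[of n j X]
  by (intro acts_trivially_onI) (simp_all add: adj_def del: fun_upd_apply)

text \<open>A nonzero term of the product forces the intermediate configuration to agree at
  \<open>j\<close> with both outer ones, and flipping \<open>j\<close> permutes the intermediate
  configurations.\<close>

lemma acts_trivially_on_mmult:
  assumes X: "acts_trivially_on n j X" and Y: "acts_trivially_on n j Y" and j: "j < n"
  shows "acts_trivially_on n j (mmult {..<n} X Y)"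
proof (rule acts_trivially_onI)
  fix a b assume a: "a \<in> cfgs {..<n}" and b: "b \<in> cfgs {..<n}"
  show "mmult {..<n} X Y a b = 0" if "a j \<noteq> b j"
    unfolding mmult_def
  proof (rule sum.neutral, rule ballI)
    fix c assume c: "c \<in> cfgs {..<n}"
    have "a j \<noteq> c j \<or> c j \<noteq> b j" using that by auto
    then have "X a c = 0 \<or> Y c b = 0"
      using trivial_eq_0[OF X a c] trivial_eq_0[OF Y c b] by blast
    then show "X a c * Y c b = 0" by simp
  qed
  have "mmult {..<n} X Y (flip_at j a) (flip_at j b)
      = (\<Sum>c\<in>cfgs {..<n}. X (flip_at j a) (flip_at j c) * Y (flip_at j c) (flip_at j b))"
    unfolding mmult_def
    by (rule sum.reindex_bij_witness[of _ "flip_at j" "flip_at j"])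
      (auto simp: flip_at_cfgs j)
  also have "\<dots> = mmult {..<n} X Y a b"
    unfolding mmult_def by (intro sum.cong refl) (simp only: trivial_flip[OF X a] trivial_flip[OF Y _ b])
  finally show "mmult {..<n} X Y (flip_at j a) (flip_at j b) = mmult {..<n} X Y a b" .
qed

lemma acts_trivially_on_lincomb:
  assumes "acts_trivially_on n j X" "acts_trivially_on n j Y"
  shows "acts_trivially_on n j (\<lambda>a b. x * X a b + y * Y a b)"
proof (rule acts_trivially_onI)
  fix a b assume ab: "a \<in> cfgs {..<n}" "b \<in> cfgs {..<n}"
  show "x * X a b + y * Y a b = 0" if "a j \<noteq> b j"
    using trivial_eq_0[OF assms(1) ab that] trivial_eq_0[OF assms(2) ab that] by simp
  show "x * X (flip_at j a) (flip_at j b) + y * Y (flip_at j a) (flip_at j b) = x * X a b + y * Y a b"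
    by (simp only: trivial_flip[OF assms(1) ab] trivial_flip[OF assms(2) ab])
qed

definition overwrite :: "nat set \<Rightarrow> cfg \<Rightarrow> cfg \<Rightarrow> cfg" where
  "overwrite J a e = (\<lambda>j. if j \<in> J then e j else a j)"

lemma overwrite_cfgs: "a \<in> cfgs S \<Longrightarrow> e \<in> cfgs S \<Longrightarrow> overwrite J a e \<in> cfgs S"
  by (auto simp: cfgs_def overwrite_def)

text \<open>The entries of an operator that is the identity on \<open>J\<close> do not depend on the
  common value of both indices there. Changing that value site by site is either no change or a
  flip.\<close>

lemma overwrite_trivial:
  assumes "J \<subseteq> {..<n}" and "\<And>j. j \<in> J \<Longrightarrow> acts_trivially_on n j X"
    and a: "a \<in> cfgs {..<n}" and b: "b \<in> cfgs {..<n}" and e: "e \<in> cfgs {..<n}"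
    and "\<And>j. j \<in> J \<Longrightarrow> a j = b j"
  shows "X (overwrite J a e) (overwrite J b e) = X a b"
proof -
  have "finite J" using assms(1) finite_subset by blast
  from this assms(1,2,6) show ?thesis
  proof (induction J rule: finite_induct)
    case empty show ?case by (simp add: overwrite_def)
  next
    case (insert k J)
    let ?a = "overwrite J a e" and ?b = "overwrite J b e"
    have eq: "overwrite (insert k J) a e = ?a(k := e k)" "overwrite (insert k J) b e = ?b(k := e k)"
      by (auto simp: overwrite_def fun_eq_iff)
    have ab: "?a k = ?b k" using insert by (auto simp: overwrite_def)
    have "X (?a(k := e k)) (?b(k := e k)) = X ?a ?b"
    proof (cases "e k = ?a k")
      case True
      then have "?a(k := e k) = ?a" "?b(k := e k) = ?b" using ab by (simp_all add: fun_upd_idem)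
      then show ?thesis by (simp only:)
    next
      case False
      then have flip: "?a(k := e k) = flip_at k ?a" "?b(k := e k) = flip_at k ?b"
        using ab by auto
      have "acts_trivially_on n k X" using insert by simp
      then show ?thesis
        unfolding flip by (rule trivial_flip[where X=X, OF _ overwrite_cfgs[OF a e] overwrite_cfgs[OF b e]])
    qed
    also have "\<dots> = X a b" using insert by simp
    finally show ?case unfolding eq .
  qed
qed

text \<open>Only one intermediate configuration survives: \<open>X\<close> forces it to equal
  \<open>a\<close> on \<open>J\<close>, and \<open>G\<close> forces it to equal \<open>b\<close> off
  \<open>J\<close>.\<close>

lemma mmult_complementary:
  assumes J: "J \<subseteq> {..<n}"
    and X: "\<And>j. j \<in> J \<Longrightarrow> acts_trivially_on n j X"
    and G: "\<And>j. j \<in> {..<n} - J \<Longrightarrow> acts_trivially_on n j G"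
    and a: "a \<in> cfgs {..<n}" and b: "b \<in> cfgs {..<n}"
  shows "mmult {..<n} X G a b = X a (overwrite J b a) * G (overwrite J b a) b"
proof -
  let ?c = "overwrite J b a"
  have "mmult {..<n} X G a b = (\<Sum>c\<in>{?c}. X a c * G c b)"
    unfolding mmult_def
  proof (rule sum.mono_neutral_right)
    show "\<forall>c\<in>cfgs {..<n} - {?c}. X a c * G c b = 0"
    proof
      fix c assume c: "c \<in> cfgs {..<n} - {?c}"
      then have "c \<noteq> ?c" by simp
      then obtain j where j: "c j \<noteq> ?c j" by (auto simp: fun_eq_iff)
      moreover have "j < n"
      proof (rule ccontr)
        assume "\<not> j < n"
        then have "\<not> c j" "\<not> ?c j" using c overwrite_cfgs[OF b a] by (auto simp: cfgs_def)
        then show False using j by simp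
      qed
      ultimately have "(j \<in> J \<and> a j \<noteq> c j) \<or> (j \<in> {..<n} - J \<and> c j \<noteq> b j)"
        by (auto simp: overwrite_def split: if_splits)
      then have "X a c = 0 \<or> G c b = 0"
        using trivial_eq_0[OF X, of j a c] trivial_eq_0[OF G, of j c b] a b c by blast
      then show "X a c * G c b = 0" by simp
    qed
  qed (use a b overwrite_cfgs finite_cfgs in auto)
  then show ?thesis by simp
qed

text \<open>Both products collapse to a single term, the second one with \<open>J\<close> and its
  complement exchanged. The factors are matched by overwriting sites on which they act
  trivially.\<close>

lemma commute_complementary:
  assumes J: "J \<subseteq> {..<n}"
    and X: "\<And>j. j \<in> J \<Longrightarrow> acts_trivially_on n j X"
    and G: "\<And>j. j \<in> {..<n} - J \<Longrightarrow> acts_trivially_on n j G"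
  shows "opeq {..<n} (mmult {..<n} X G) (mmult {..<n} G X)"
  unfolding opeq_def
proof (intro ballI)
  fix a b assume a: "a \<in> cfgs {..<n}" and b: "b \<in> cfgs {..<n}"
  let ?K = "{..<n} - J"
  have K: "overwrite ?K b a = overwrite J a b"
    using a b J by (auto simp: overwrite_def cfgs_def fun_eq_iff)
  have "X a (overwrite J b a) = X (overwrite J a b) (overwrite J (overwrite J b a) b)"
    by (rule overwrite_trivial[where X=X and a=a and b="overwrite J b a" and e=b, OF J X, symmetric])
      (use a b overwrite_cfgs in \<open>auto simp: overwrite_def\<close>)
  also have "overwrite J (overwrite J b a) b = b" by (auto simp: overwrite_def)
  finally have 1: "X a (overwrite J b a) = X (overwrite J a b) b" .
  have "G (overwrite J b a) b = G (overwrite ?K (overwrite J b a) a) (overwrite ?K b a)"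
    by (rule overwrite_trivial[where X=G and a="overwrite J b a" and b=b and e=a, OF _ G, symmetric])
      (use a b overwrite_cfgs in \<open>auto simp: overwrite_def\<close>)
  also have "overwrite ?K (overwrite J b a) a = a"
    using a b by (auto simp: overwrite_def cfgs_def fun_eq_iff)
  finally have 2: "G (overwrite J b a) b = G a (overwrite J a b)" by (simp add: K)
  have "mmult {..<n} G X a b = G a (overwrite ?K b a) * X (overwrite ?K b a) b"
    by (rule mmult_complementary) (use X G a b J in \<open>auto simp: double_diff\<close>)
  then show "mmult {..<n} X G a b = mmult {..<n} G X a b"
    using mmult_complementary[OF J X G a b] by (simp add: 1 2 K)
qed

section \<open>Heisenberg evolution through gates and layers\<close>

abbreviation conjugate :: "nat \<Rightarrow> qop \<Rightarrow> qop \<Rightarrow> qop" where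
  "conjugate n U X \<equiv> mmult {..<n} (adj U) (mmult {..<n} X U)"

text \<open>The order reverses: the outer factor \<open>U\<close>, applied last to a state, is the
  first to act on the observable.\<close>

lemma conjugate_mmult: "conjugate n (mmult {..<n} U V) X = conjugate n V (conjugate n U X)"
  by (simp add: adj_mmult mmult_assoc)

lemma conjugate_disjoint:
  assumes J: "J \<subseteq> {..<n}"
    and X: "\<And>j. j \<in> J \<Longrightarrow> acts_trivially_on n j X"
    and G: "\<And>j. j \<in> {..<n} - J \<Longrightarrow> acts_trivially_on n j G"
    and U: "is_unitary {..<n} G"
  shows "opeq {..<n} (conjugate n G X) X"
proof -
  have "opeq {..<n} (conjugate n G X) (mmult {..<n} (adj G) (mmult {..<n} G X))"
    by (rule opeq_mmult[OF opeq_refl commute_complementary[OF J X G]])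
  moreover have "opeq {..<n} (mmult {..<n} (mmult {..<n} (adj G) G) X) (mmult {..<n} (ident {..<n}) X)"
    by (rule opeq_mmult[OF _ opeq_refl]) (use U in \<open>simp add: is_unitary_iff\<close>)
  ultimately show ?thesis
    using opeq_ident_mmult[of "{..<n}" X] by (simp add: mmult_assoc) (blast intro: opeq_trans)
qed

definition local_gate :: "nat \<Rightarrow> nat \<Rightarrow> qop \<Rightarrow> bool" where
  "local_gate n j G \<longleftrightarrow> is_unitary {..<n} G \<and> Suc j < n \<and>
     (\<forall>i<n. i \<noteq> j \<longrightarrow> i \<noteq> Suc j \<longrightarrow> acts_trivially_on n i G)"

text \<open>\<open>T\<close> bounds the support and does not cut the brick of the gate. A brick
  inside \<open>T\<close> cannot lead out of \<open>T\<close>; a brick outside \<open>T\<close>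
  commutes with \<open>X\<close> and cancels against its adjoint.\<close>

lemma conjugate_gate_trivial:
  assumes G: "local_gate n j G" and T: "j \<in> T \<longleftrightarrow> Suc j \<in> T"
    and X: "\<And>i. i < n \<Longrightarrow> i \<notin> T \<Longrightarrow> acts_trivially_on n i X"
    and i: "i < n" "i \<notin> T"
  shows "acts_trivially_on n i (conjugate n G X)"
proof (cases "j \<in> T")
  case True
  then have "acts_trivially_on n i G" using G T i unfolding local_gate_def by blast
  then show ?thesis
    by (intro acts_trivially_on_mmult acts_trivially_on_adj X i)
next
  case False
  have "opeq {..<n} (conjugate n G X) X"
    by (rule conjugate_disjoint[of "{j, Suc j}"]) (use G T X False in \<open>auto simp: local_gate_def\<close>)
  then show ?thesis using acts_trivially_on_opeq[OF opeq_sym X] i by blast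
qed

text \<open>A single \<open>T\<close> respects all bricks of the layer, so the bound passes
  unchanged from gate to gate and the order of the gates is immaterial.\<close>

lemma conjugate_layer_trivial:
  assumes "\<And>j. j \<in> set js \<Longrightarrow> local_gate n j (G j)"
    and "\<And>j. j \<in> set js \<Longrightarrow> j \<in> T \<longleftrightarrow> Suc j \<in> T"
    and "\<And>i. i < n \<Longrightarrow> i \<notin> T \<Longrightarrow> acts_trivially_on n i X"
    and "i < n" "i \<notin> T"
  shows "acts_trivially_on n i (conjugate n (foldr (\<lambda>j M. mmult {..<n} (G j) M) js (ident {..<n})) X)"
  using assms
proof (induction js arbitrary: X i)
  case Nil
  then show ?case
    by (simp add: adj_ident acts_trivially_on_mmult acts_trivially_on_ident)
next
  case (Cons j js)
  have "acts_trivially_on n i (conjugate n (G j) X)" if "i < n" "i \<notin> T" for i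
    by (rule conjugate_gate_trivial[OF Cons.prems(1,2,3) that]) auto
  then show ?case
    unfolding foldr.simps comp_def conjugate_mmult
    by (intro Cons.IH) (use Cons.prems in auto)
qed

lemma unitary_layer:
  assumes "\<And>j. j \<in> set js \<Longrightarrow> is_unitary {..<n} (G j)"
  shows "is_unitary {..<n} (foldr (\<lambda>j M. mmult {..<n} (G j) M) js (ident {..<n}))"
  using assms by (induction js) (auto simp: is_unitary_ident intro!: is_unitary_mmult)

text \<open>Bricks of layer \<open>l\<close> start at positions \<open>j\<close> with \<open>j + l + s\<close> even, so an interval starting at
  such a position (and ending just before one) is a union of bricks. Positions are integers
  since the light cone may be cut off by the boundary of the chain.\<close>

definition cone :: "nat \<Rightarrow> ('q \<Rightarrow> int) \<Rightarrow> nat \<Rightarrow> 'q set \<Rightarrow> nat set" where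
  "cone n x t Q = {j. j < n \<and> (\<exists>q\<in>Q. x q - int t \<le> int j \<and> int j \<le> x q + int t + 1)}"

text \<open>Each interval has even length \<open>2 (t + 1)\<close>, so the parity of its left end
  also fixes that of its right end, and no brick of layer \<open>l\<close> straddles either of
  them.\<close>

lemma cone_brick_closed:
  assumes x: "\<And>q. q \<in> Q \<Longrightarrow> even (x q - int t + int l + int s)"
    and j: "j \<in> set (hea_pairs n s l)"
  shows "j \<in> cone n x t Q \<longleftrightarrow> Suc j \<in> cone n x t Q"
proof -
  have jn: "Suc j < n" and ev: "even (int j + int l + int s)"
    using j by (auto simp: hea_pairs_def simp flip: of_nat_add)
  have "x q - int t \<le> int j \<and> int j \<le> x q + int t + 1 \<longleftrightarrow>
      x q - int t \<le> int (Suc j) \<and> int (Suc j) \<le> x q + int t + 1" if "q \<in> Q" for q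
  proof -
    have "even (x q - int t - int j)" using x[OF that] ev by presburger
    then show ?thesis by presburger
  qed
  then show ?thesis using jn by (auto simp: cone_def)
qed

lemma cone_mono: "cone n x t Q \<subseteq> cone n x (Suc t) Q"
  unfolding cone_def by force

lemma card_cone:
  assumes "finite Q"
  shows "card (cone n x t Q) \<le> 2 * (t + 1) * card Q"
proof -
  have "int ` cone n x t Q \<subseteq> (\<Union>q\<in>Q. {x q - int t..x q + int t + 1})" by (auto simp: cone_def)
  then have "card (int ` cone n x t Q) \<le> card (\<Union>q\<in>Q. {x q - int t..x q + int t + 1})"
    using assms by (intro card_mono) auto
  also have "\<dots> \<le> (\<Sum>q\<in>Q. card {x q - int t..x q + int t + 1})"
    using assms by (rule card_UN_le)
  also have "\<dots> = 2 * (t + 1) * card Q" by (simp add: nat_add_distrib nat_mult_distrib)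
  finally show ?thesis by (simp add: card_image)
qed

text \<open>Here \<open>d\<close> counts the layers still to be met and \<open>t\<close> the
  widenings already made. Meeting layer \<open>d - 1\<close> lowers the one and raises the other, so
  the parity of \<open>x q - t + d + s\<close> is preserved: this is where the alternation of the
  bricks enters.\<close>

lemma conjugate_hea_trivial:
  assumes gates: "\<And>l j. l < d \<Longrightarrow> j \<in> set (hea_pairs n s l) \<Longrightarrow> local_gate n j (hea_gate n \<theta> H V l j)"
    and x: "\<And>q. q \<in> Q \<Longrightarrow> even (x q - int t + int d + int s)"
    and X: "\<And>i. i < n \<Longrightarrow> i \<notin> cone n x t Q \<Longrightarrow> acts_trivially_on n i X"
    and i: "i < n" "i \<notin> cone n x (t + d) Q"
  shows "acts_trivially_on n i (conjugate n (hea_unitary n \<theta> H V s d) X)"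
  using assms
proof (induction d arbitrary: X i t)
  case 0
  then show ?case
    by (simp add: adj_ident acts_trivially_on_mmult acts_trivially_on_ident)
next
  case (Suc d)
  let ?X = "conjugate n (hea_layer n \<theta> H V s d) X"
  have ev: "even (x q - int (Suc t) + int d + int s)" if "q \<in> Q" for q
    using Suc.prems(2)[OF that] by presburger
  have "acts_trivially_on n i ?X" if "i < n" "i \<notin> cone n x (Suc t) Q" for i
    unfolding hea_layer_def
  proof (rule conjugate_layer_trivial[where T="cone n x (Suc t) Q"])
    show "acts_trivially_on n i X" if "i < n" "i \<notin> cone n x (Suc t) Q" for i
      using Suc.prems(3) that cone_mono by blast
    show "j \<in> cone n x (Suc t) Q \<longleftrightarrow> Suc j \<in> cone n x (Suc t) Q"
      if "j \<in> set (hea_pairs n s d)" for j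
      using cone_brick_closed[OF ev that] .
  qed (use Suc.prems that in auto)
  then show ?case
    unfolding hea_unitary.simps conjugate_mmult
    by (intro Suc.IH[where t="Suc t"]) (use Suc.prems ev in auto)
qed

lemma unitary_hea:
  assumes "\<And>l j. l < d \<Longrightarrow> j \<in> set (hea_pairs n s l) \<Longrightarrow> local_gate n j (hea_gate n \<theta> H V l j)"
  shows "is_unitary {..<n} (hea_unitary n \<theta> H V s d)"
  using assms
proof (induction d)
  case (Suc d)
  have "is_unitary {..<n} (hea_unitary n \<theta> H V s d)" by (rule Suc.IH) (use Suc.prems in simp)
  then show ?case
    unfolding hea_unitary.simps hea_layer_def
    by (intro is_unitary_mmult unitary_layer) (use Suc.prems in \<open>auto simp: local_gate_def\<close>)
qed (simp add: is_unitary_ident)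

text \<open>The layer met first is split off from the induction because it only completes each site
  to a brick, giving radius \<open>t = 0\<close>. The remaining \<open>d - 1\<close> layers lead to
  radius \<open>d - 1\<close>, hence to at most \<open>2 d\<close> sites per qubit.\<close>

lemma light_cone:
  assumes gates: "\<And>l j. l < d \<Longrightarrow> j \<in> set (hea_pairs n s l) \<Longrightarrow> local_gate n j (hea_gate n \<theta> H V l j)"
    and d: "d \<ge> 1"
  shows "card (supp n (conjugate n (hea_unitary n \<theta> H V s d) X)) \<le> 2 * d * card (supp n X)"
proof -
  obtain e where e: "d = Suc e" using d by (cases d) auto
  let ?Q = "supp n X"
  \<comment> \<open>The left end of the brick of layer \<open>e\<close> containing \<open>q\<close>.
    It is -1 when the brick would stick out of the chain on the left.\<close>
  define x where "x q = (if even (int q + int e + int s) then int q else int q - 1)" for q :: nat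
  have ev: "even (x q - int 0 + int e + int s)" for q by (auto simp: x_def)
  have Q: "finite ?Q" by (simp add: supp_def)
  let ?X = "conjugate n (hea_layer n \<theta> H V s e) X"
  have L: "acts_trivially_on n i ?X" if i: "i < n" "i \<notin> cone n x 0 ?Q" for i
    unfolding hea_layer_def
  proof (rule conjugate_layer_trivial[where T="cone n x 0 ?Q"])
    show "acts_trivially_on n i X" if "i < n" "i \<notin> cone n x 0 ?Q" for i
    proof (rule ccontr)
      assume "\<not> acts_trivially_on n i X"
      then have "i \<in> ?Q" using that by (simp add: supp_def)
      then have "i \<in> cone n x 0 ?Q" using that by (auto simp: cone_def x_def intro!: bexI[of _ i])
      then show False using that by simp
    qed
    show "j \<in> cone n x 0 ?Q \<longleftrightarrow> Suc j \<in> cone n x 0 ?Q"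
      if "j \<in> set (hea_pairs n s e)" for j
      using cone_brick_closed[OF ev that] .
  qed (use gates e i in auto)
  have "acts_trivially_on n i (conjugate n (hea_unitary n \<theta> H V s d) X)"
    if "i < n" "i \<notin> cone n x e ?Q" for i
    unfolding e hea_unitary.simps conjugate_mmult
    by (rule conjugate_hea_trivial[where t=0 and x=x and Q="?Q"]) (use gates e ev L that in auto)
  then have "supp n (conjugate n (hea_unitary n \<theta> H V s d) X) \<subseteq> cone n x e ?Q"
    unfolding supp_def by blast
  then have "card (supp n (conjugate n (hea_unitary n \<theta> H V s d) X)) \<le> card (cone n x e ?Q)"
    by (rule card_mono[rotated]) (simp add: cone_def)
  also have "\<dots> \<le> 2 * d * card ?Q" using card_cone[OF Q] e by simp
  finally show ?thesis .
qed

section \<open>Pauli strings and gates\<close>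

lemma pauli1_hermitian: "cnj (pauli1 k y x) = pauli1 k x y"
  by (simp add: pauli1_def)

lemma pauli1_square:
  "pauli1 k x False * pauli1 k False y + pauli1 k x True * pauli1 k True y = (if x = y then 1 else 0)"
  by (cases x; cases y) (auto simp: pauli1_def)

lemma pauli1_orthogonal:
  assumes "k < 4" "l < 4"
  shows "pauli1 k False False * cnj (pauli1 l False False) + pauli1 k False True * cnj (pauli1 l False True)
    + (pauli1 k True False * cnj (pauli1 l True False) + pauli1 k True True * cnj (pauli1 l True True))
    = (if k = l then 2 else 0)"
proof -
  have "k = 0 \<or> k = 1 \<or> k = 2 \<or> k = 3" "l = 0 \<or> l = 1 \<or> l = 2 \<or> l = 3"
    using assms by auto
  then show ?thesis by (elim disjE) (simp_all add: pauli1_def)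
qed

lemma cfgs_lessThan_Suc:
  "cfgs {..<Suc n} = cfgs {..<n} \<union> (\<lambda>c. c(n := True)) ` cfgs {..<n}"
proof (intro set_eqI iffI)
  fix a assume a: "a \<in> cfgs {..<Suc n}"
  show "a \<in> cfgs {..<n} \<union> (\<lambda>c. c(n := True)) ` cfgs {..<n}"
  proof (cases "a n")
    case True
    then have "a = (a(n := False))(n := True)" by (simp add: fun_eq_iff)
    moreover have "a(n := False) \<in> cfgs {..<n}" using a by (auto simp: cfgs_def less_Suc_eq)
    ultimately show ?thesis by blast
  next
    case False
    then show ?thesis using a unfolding cfgs_def by (auto simp: less_Suc_eq)
  qed
qed (auto simp: cfgs_def)

text \<open>Distributivity over the single qubits; it reduces products and orthogonality of Pauli
  strings to identities for 2 by 2 matrices.\<close>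

lemma sum_cfgs_prod:
  fixes g :: "nat \<Rightarrow> bool \<Rightarrow> complex"
  shows "(\<Sum>c\<in>cfgs {..<n}. \<Prod>j<n. g j (c j)) = (\<Prod>j<n. g j False + g j True)"
proof (induction n)
  case 0
  have "cfgs {} = {\<lambda>_. False}" by (auto simp: cfgs_def)
  then show ?case by (simp add: lessThan_def)
next
  case (Suc n)
  let ?K = "cfgs {..<n}" and ?u = "\<lambda>c::cfg. c(n := True)"
  have nf: "\<not> c n" if "c \<in> ?K" for c using that by (simp add: cfgs_def)
  have inj: "inj_on ?u ?K"
  proof (rule inj_onI)
    fix c d assume cd: "c \<in> ?K" "d \<in> ?K" and "?u c = ?u d"
    then have "(?u c)(n := False) = (?u d)(n := False)" by simp
    moreover have "(?u c)(n := False) = c" "(?u d)(n := False) = d"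
      using nf[OF cd(1)] nf[OF cd(2)] by (auto simp: fun_eq_iff)
    ultimately show "c = d" by simp
  qed
  have "(\<Sum>c\<in>cfgs {..<Suc n}. \<Prod>j<Suc n. g j (c j))
      = (\<Sum>c\<in>?K. \<Prod>j<Suc n. g j (c j)) + (\<Sum>c\<in>?u ` ?K. \<Prod>j<Suc n. g j (c j))"
    unfolding cfgs_lessThan_Suc
    by (rule sum.union_disjoint) (auto simp: finite_cfgs dest: nf)
  also have "(\<Sum>c\<in>?u ` ?K. \<Prod>j<Suc n. g j (c j)) = (\<Sum>c\<in>?K. (\<Prod>j<n. g j (c j)) * g n True)"
    by (subst sum.reindex[OF inj]) (auto intro!: sum.cong prod.cong)
  also have "(\<Sum>c\<in>?K. \<Prod>j<Suc n. g j (c j)) = (\<Sum>c\<in>?K. (\<Prod>j<n. g j (c j)) * g n False)"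
    by (rule sum.cong) (auto simp: nf)
  finally show ?case by (simp add: sum_distrib_right[symmetric] Suc.IH distrib_left)
qed

lemma adj_pauli_string: "adj (pauli_string n p) = pauli_string n p"
  by (simp add: fun_eq_iff adj_def pauli_string_def pauli1_hermitian)

lemma cfgs_eqI: "a \<in> cfgs S \<Longrightarrow> b \<in> cfgs S \<Longrightarrow> (\<And>j. j \<in> S \<Longrightarrow> a j = b j) \<Longrightarrow> a = b"
  unfolding cfgs_def fun_eq_iff by blast

lemma pauli_string_square:
  "opeq {..<n} (mmult {..<n} (pauli_string n p) (pauli_string n p)) (ident {..<n})"
  unfolding opeq_def
proof (intro ballI)
  fix a b assume ab: "a \<in> cfgs {..<n}" "b \<in> cfgs {..<n}"
  have "mmult {..<n} (pauli_string n p) (pauli_string n p) a b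
      = (\<Sum>c\<in>cfgs {..<n}. \<Prod>j<n. pauli1 (p j) (a j) (c j) * pauli1 (p j) (c j) (b j))"
    by (simp add: mmult_def pauli_string_def prod.distrib)
  also have "\<dots> = (\<Prod>j<n. if a j = b j then 1 else 0)"
    unfolding sum_cfgs_prod[where g="\<lambda>j x. pauli1 (p j) (a j) x * pauli1 (p j) x (b j)"]
    by (simp only: pauli1_square)
  also have "\<dots> = ident {..<n} a b"
  proof (cases "a = b")
    case True then show ?thesis using ab by (simp add: ident_def)
  next
    case False
    then obtain j where "j < n" "a j \<noteq> b j" using cfgs_eqI[OF ab] by auto
    then have "(\<Prod>j<n. if a j = b j then 1 else 0) = (0::complex)"
      by (intro prod_zero) auto
    then show ?thesis using False by (simp add: ident_def)
  qed
  finally show "mmult {..<n} (pauli_string n p) (pauli_string n p) a b = ident {..<n} a b" .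
qed

lemma is_unitary_pauli_string: "is_unitary {..<n} (pauli_string n p)"
  by (simp add: is_unitary_iff adj_pauli_string pauli_string_square)

lemma pauli_string_orthogonal:
  assumes p: "is_pauli_label n p" and q: "is_pauli_label n q"
  shows "(\<Sum>a\<in>cfgs {..<n}. \<Sum>b\<in>cfgs {..<n}. pauli_string n p a b * cnj (pauli_string n q a b))
    = (if p = q then 2 ^ n else 0)"
proof -
  let ?h = "\<lambda>j x y. pauli1 (p j) x y * cnj (pauli1 (q j) x y)"
  have "(\<Sum>a\<in>cfgs {..<n}. \<Sum>b\<in>cfgs {..<n}. pauli_string n p a b * cnj (pauli_string n q a b))
      = (\<Sum>a\<in>cfgs {..<n}. \<Sum>b\<in>cfgs {..<n}. \<Prod>j<n. ?h j (a j) (b j))"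
    by (simp add: pauli_string_def prod.distrib)
  also have "\<dots> = (\<Sum>a\<in>cfgs {..<n}. \<Prod>j<n. ?h j (a j) False + ?h j (a j) True)"
    by (rule sum.cong[OF refl]) (rule sum_cfgs_prod)
  also have "\<dots> = (\<Prod>j<n. (?h j False False + ?h j False True) + (?h j True False + ?h j True True))"
    by (rule sum_cfgs_prod)
  also have "\<dots> = (\<Prod>j<n. if p j = q j then 2 else 0)"
    by (rule prod.cong[OF refl], rule pauli1_orthogonal) (use p q in \<open>auto simp: is_pauli_label_def\<close>)
  also have "\<dots> = (if p = q then 2 ^ n else 0)"
  proof (cases "p = q")
    case False
    then obtain j where "p j \<noteq> q j" by (auto simp: fun_eq_iff)
    moreover from this have "j < n" using p q unfolding is_pauli_label_def by (metis not_le)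
    ultimately have "(\<Prod>j<n. if p j = q j then 2 else 0) = (0::complex)"
      by (intro prod_zero) auto
    then show ?thesis using False by simp
  qed simp
  finally show ?thesis .
qed

text \<open>Turns a bound on the operator support into a bound on the weight of the label, which is
  what the counting of strings uses.\<close>

lemma supp_pauli_string: "{j. j < n \<and> p j \<noteq> 0} \<subseteq> supp n (pauli_string n p)"
proof
  fix j assume "j \<in> {j. j < n \<and> p j \<noteq> 0}"
  then have j: "j < n" "p j \<noteq> 0" by auto
  define a :: cfg where "a = (\<lambda>_. False)"
  \<comment> \<open>The labels 1 and 2 are off-diagonal and all others diagonal, so this
    \<open>b\<close> picks the nonzero entry in the first row of every factor.\<close>
  define b :: cfg where "b i \<longleftrightarrow> i < n \<and> (p i = 1 \<or> p i = 2)" for i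
  have ab: "a \<in> cfgs {..<n}" "b \<in> cfgs {..<n}" by (auto simp: a_def b_def cfgs_def)
  have nz: "pauli_string n p a b \<noteq> 0"
    unfolding pauli_string_def by (auto simp: prod_zero_iff a_def b_def pauli1_def)
  have "\<not> acts_trivially_on n j (pauli_string n p)"
  proof
    assume T: "acts_trivially_on n j (pauli_string n p)"
    \<comment> \<open>Triviality at \<open>j\<close> excludes the off-diagonal labels; what is left
      acts as Z, whose diagonal entries differ in sign, against invariance under the flip.\<close>
    have "p j \<noteq> 1" "p j \<noteq> 2" using trivial_eq_0[OF T ab] nz j by (auto simp: a_def b_def)
    then have "pauli1 (p j) True True = - pauli1 (p j) False False"
      using j by (simp add: pauli1_def)
    moreover have "\<not> a j" "\<not> b j" using \<open>p j \<noteq> 1\<close> \<open>p j \<noteq> 2\<close> by (auto simp: a_def b_def)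
    ultimately have "pauli_string n p (flip_at j a) (flip_at j b) = - pauli_string n p a b"
      unfolding pauli_string_def using j(1)
      by (subst (1 2) prod.remove[of _ j]) (auto intro!: prod.cong)
    then show False using trivial_flip[OF T ab] nz by simp
  qed
  then show "j \<in> supp n (pauli_string n p)" using j by (simp add: supp_def)
qed

lemma mmult_lincomb:
  "mmult S (\<lambda>a b. x * A a b + y * B a b) (\<lambda>a b. z * C a b + w * D a b) a b
    = x * z * mmult S A C a b + x * w * mmult S A D a b
      + (y * z * mmult S B C a b + y * w * mmult S B D a b)"
  by (simp add: mmult_def sum.distrib sum_distrib_left algebra_simps)

text \<open>As \<open>P\<^sup>2 = 1\<close>, the exponential series of \<open>zP\<close> splits into its even and odd part.\<close>

lemma mexp_involution:
  assumes fin: "finite S" and P: "opeq S (mmult S P P) (ident S)"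
  shows "opeq S (mexp S (\<lambda>a b. z * P a b))
    (\<lambda>a b. (exp z + exp (- z)) / 2 * ident S a b + (exp z - exp (- z)) / 2 * P a b)"
proof -
  let ?A = "\<lambda>a b. z * P a b"
  have pow: "opeq S (mpow S ?A k) (\<lambda>a b. z ^ k * (if even k then ident S a b else P a b))" for k
  proof (induction k)
    case 0 show ?case by simp
  next
    case (Suc k)
    have "opeq S (mpow S ?A (Suc k))
        (mmult S ?A (\<lambda>a b. z ^ k * (if even k then ident S a b else P a b)))"
      using opeq_mmult[OF opeq_refl Suc] by simp
    moreover have "mmult S ?A (\<lambda>a b. z ^ k * (if even k then ident S a b else P a b))
        = (\<lambda>a b. z ^ Suc k * (if even k then mmult S P (ident S) a b else mmult S P P a b))"
      by (auto simp: fun_eq_iff mmult_def sum_distrib_left mult_ac)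
    moreover have "opeq S (mmult S P (ident S)) P" by (rule opeq_mmult_ident[OF fin])
    ultimately show ?case using P by (auto simp: opeq_def)
  qed
  show ?thesis unfolding opeq_def
  proof (intro ballI)
    fix a b assume ab: "a \<in> cfgs S" "b \<in> cfgs S"
    have E: "(\<lambda>k. w ^ k / of_nat (fact k)) sums exp w" for w :: complex
      using exp_converges[of w] by (simp add: scaleR_conv_of_real divide_inverse mult.commute)
    \<comment> \<open>Half the sum and half the difference of the series at \<open>z\<close> and
      \<open>- z\<close> select the even and the odd powers.\<close>
    have series: "mpow S ?A k a b / of_nat (fact k)
        = (z ^ k / of_nat (fact k) + (- z) ^ k / of_nat (fact k)) / 2 * ident S a b
          + (z ^ k / of_nat (fact k) - (- z) ^ k / of_nat (fact k)) / 2 * P a b" for k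
      using pow[of k] ab by (simp add: opeq_def field_simps)
    have "(\<lambda>k. mpow S ?A k a b / of_nat (fact k)) sums
        ((exp z + exp (- z)) / 2 * ident S a b + (exp z - exp (- z)) / 2 * P a b)"
      unfolding series
      by (intro sums_add sums_mult2 sums_divide sums_diff E)
    then show "mexp S ?A a b
        = (exp z + exp (- z)) / 2 * ident S a b + (exp z - exp (- z)) / 2 * P a b"
      unfolding mexp_def by (rule sums_unique[symmetric])
  qed
qed

text \<open>The coefficients are \<open>c = cosh z\<close> and \<open>d = sinh z\<close>. For
  imaginary \<open>z\<close> the first is real and the second imaginary, so the adjoint is
  \<open>c - d P\<close>, and its product with \<open>c + d P\<close> is
  \<open>c\<^sup>2 - d\<^sup>2 = 1\<close>.\<close>

lemma is_unitary_rotation: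
  assumes fin: "finite S" and P: "opeq S (mmult S P P) (ident S)" and herm: "adj P = P"
    and z: "cnj z = - z"
  shows "is_unitary S (\<lambda>a b. (exp z + exp (- z)) / 2 * ident S a b + (exp z - exp (- z)) / 2 * P a b)"
proof -
  define c d where "c = (exp z + exp (- z)) / 2" and "d = (exp z - exp (- z)) / 2"
  let ?M = "\<lambda>a b. c * ident S a b + d * P a b"
  have cd: "cnj c = c" "cnj d = - d"
    by (simp_all only: c_def d_def complex_cnj_divide complex_cnj_add complex_cnj_diff
        complex_cnj_numeral exp_cnj complex_cnj_minus z minus_minus add.commute
        minus_divide_left minus_diff_eq)
  have adj: "adj ?M = (\<lambda>a b. c * ident S a b + (- d) * P a b)"
  proof (intro ext)
    fix a b
    have "adj ?M a b = cnj c * adj (ident S) a b + cnj d * adj P a b" by (simp add: adj_def)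
    then show "adj ?M a b = c * ident S a b + (- d) * P a b" by (simp only: cd herm adj_ident)
  qed
  have "exp z * exp (- z) = 1" by (simp flip: exp_add)
  moreover have "c * c - d * d = exp z * exp (- z)" by (simp add: c_def d_def field_simps)
  ultimately have one: "c * c - d * d = 1" by simp
  have I: "mmult S (ident S) (ident S) a b = ident S a b" "mmult S (ident S) P a b = P a b"
    "mmult S P (ident S) a b = P a b" "mmult S P P a b = ident S a b"
    if "a \<in> cfgs S" "b \<in> cfgs S" for a b
    using opeq_ident_mmult[OF fin] opeq_mmult_ident[OF fin] P that by (auto simp: opeq_def)
  have "c * c * x + c * (- d) * y + (d * c * y + d * (- d) * x) = x"
    "c * c * x + c * d * y + (- d * c * y + (- d) * d * x) = x" for x y
    using one by (auto simp: algebra_simps simp flip: distrib_left left_diff_distrib)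
  then have "is_unitary S ?M"
    unfolding is_unitary_iff opeq_def adj mmult_lincomb by (simp add: I)
  then show ?thesis by (simp add: c_def d_def)
qed

text \<open>Unitarity and locality are established for the closed form \<open>M\<close> of the
  exponential and carried over to the series by \<open>opeq\<close>.\<close>

lemma local_gate_hea:
  assumes valid: "valid_hea n D s H V" and l: "l < D" and j: "j \<in> set (hea_pairs n s l)"
  shows "local_gate n j (hea_gate n \<theta> H V l j)"
proof -
  let ?N = "{..<n}" and ?H = "H l j"
  define z where "z = - \<i> * of_real (\<theta> l j)"
  define M where "M = (\<lambda>a b. (exp z + exp (- z)) / 2 * ident ?N a b + (exp z - exp (- z)) / 2 * ?H a b)"
  have v: "\<exists>p. is_pauli_label n p \<and> ?H = pauli_string n p" "supp n ?H \<subseteq> {j, Suc j}"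
    "is_unitary ?N (V l j)" "supp n (V l j) \<subseteq> {j, Suc j}"
    using valid l j unfolding valid_hea_def by blast+
  then obtain p where p: "?H = pauli_string n p" by blast
  have z: "cnj z = - z" by (simp add: z_def)
  have exp: "opeq ?N M (mexp ?N (\<lambda>a b. z * ?H a b))"
    unfolding M_def p by (rule opeq_sym, rule mexp_involution[OF _ pauli_string_square]) simp
  have "is_unitary ?N M"
    unfolding M_def p
    by (rule is_unitary_rotation[OF _ pauli_string_square adj_pauli_string z]) simp
  then have U: "is_unitary ?N (mexp ?N (\<lambda>a b. z * ?H a b))"
    using is_unitary_opeq[OF exp] by blast
  have gate: "hea_gate n \<theta> H V l j = mmult ?N (mexp ?N (\<lambda>a b. z * ?H a b)) (V l j)"
    by (simp add: hea_gate_def z_def)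
  have "acts_trivially_on n i (hea_gate n \<theta> H V l j)" if i: "i < n" "i \<noteq> j" "i \<noteq> Suc j" for i
  proof -
    have "acts_trivially_on n i ?H" "acts_trivially_on n i (V l j)"
      using v i unfolding supp_def by blast+
    moreover from this have "acts_trivially_on n i M"
      unfolding M_def by (intro acts_trivially_on_lincomb acts_trivially_on_ident i)
    ultimately show ?thesis
      unfolding gate
      by (intro acts_trivially_on_mmult acts_trivially_on_opeq[OF exp] i)
  qed
  moreover have "Suc j < n" using j by (auto simp: hea_pairs_def)
  moreover have "is_unitary ?N (hea_gate n \<theta> H V l j)"
    unfolding gate by (rule is_unitary_mmult[OF _ U v(3)]) simp
  ultimately show ?thesis by (simp add: local_gate_def)
qed

section \<open>Reduced states\<close>

lemma joinc_cfgs: "a \<in> cfgs A \<Longrightarrow> c \<in> cfgs B \<Longrightarrow> joinc a c \<in> cfgs (A \<union> B)"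
  by (auto simp: cfgs_def joinc_def)

lemma sum_cfgs_split:
  assumes "A \<inter> B = {}"
  shows "(\<Sum>a\<in>cfgs (A \<union> B). f a) = (\<Sum>a\<in>cfgs A. \<Sum>c\<in>cfgs B. f (joinc a c))"
proof -
  have "joinc (\<lambda>j. j \<in> A \<and> a j) (\<lambda>j. j \<in> B \<and> a j) = a" if "a \<in> cfgs (A \<union> B)" for a
    using that by (auto simp: cfgs_def joinc_def fun_eq_iff)
  moreover have "(\<lambda>j. j \<in> A \<and> joinc a c j) = a" "(\<lambda>j. j \<in> B \<and> joinc a c j) = c"
    if "a \<in> cfgs A" "c \<in> cfgs B" for a c
    using that assms unfolding cfgs_def joinc_def fun_eq_iff by blast+
  moreover have "(\<lambda>j. j \<in> A \<and> a j) \<in> cfgs A" "(\<lambda>j. j \<in> B \<and> a j) \<in> cfgs B" for a :: cfg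
    by (simp_all add: cfgs_def)
  ultimately show ?thesis
    unfolding sum.cartesian_product
    by (intro sum.reindex_bij_witness[of _ "\<lambda>(a, c). joinc a c"
          "\<lambda>a. (\<lambda>j. j \<in> A \<and> a j, \<lambda>j. j \<in> B \<and> a j)"])
      (auto simp: joinc_cfgs)
qed

lemma cfgs_mono: "A \<subseteq> B \<Longrightarrow> cfgs A \<subseteq> cfgs B"
  by (auto simp: cfgs_def)

text \<open>The setting in which \<open>X\<close> is an operator on \<Lambda> tensored with the
  identity on \<open>K\<close>. The first factor gets no name of its own: its entries are those of
  \<open>X\<close> over \<open>cfgs \<Lambda>\<close>.\<close>

locale trivial_outside =
  fixes n :: nat and \<Lambda> K :: "nat set" and X :: qop
  assumes \<Lambda>: "\<Lambda> \<subseteq> {..<n}" and K: "K = {..<n} - \<Lambda>"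
    and X: "j \<in> K \<Longrightarrow> acts_trivially_on n j X"
begin

lemma union: "\<Lambda> \<union> K = {..<n}" and disj: "\<Lambda> \<inter> K = {}"
  and fin: "finite \<Lambda>" "finite K"
  using \<Lambda> finite_subset[OF \<Lambda>] by (auto simp: K)

lemma sum_split: "(\<Sum>a\<in>cfgs {..<n}. f a) = (\<Sum>a\<in>cfgs \<Lambda>. \<Sum>c\<in>cfgs K. f (joinc a c))"
  using sum_cfgs_split[OF disj, of f] by (simp add: union)

text \<open>The tensor factorization in coordinates. Different parts on \<open>K\<close> give 0 by
  triviality; a common part may be reset to False everywhere.\<close>

lemma kernel_joinc:
  assumes "a \<in> cfgs \<Lambda>" "b \<in> cfgs \<Lambda>" "c \<in> cfgs K" "d \<in> cfgs K"
  shows "X (joinc a c) (joinc b d) = (if c = d then X a b else 0)"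
proof -
  have ac: "joinc a c \<in> cfgs {..<n}" and bd: "joinc b d \<in> cfgs {..<n}"
    using joinc_cfgs assms union by metis+
  have aK: "\<not> a j" "\<not> b j" if "j \<in> K" for j using assms that by (auto simp: cfgs_def K)
  show ?thesis
  proof (cases "c = d")
    case True
    have a: "overwrite K (joinc a c) (\<lambda>_. False) = a"
      and b: "overwrite K (joinc b d) (\<lambda>_. False) = b"
      using assms aK by (auto simp: overwrite_def joinc_def cfgs_def fun_eq_iff)
    have "X (overwrite K (joinc a c) (\<lambda>_. False)) (overwrite K (joinc b d) (\<lambda>_. False))
        = X (joinc a c) (joinc b d)"
      by (rule overwrite_trivial[where X=X, OF _ X ac bd])
        (use True aK in \<open>auto simp: K cfgs_def joinc_def\<close>)
    then have "X (joinc a c) (joinc b d) = X a b" unfolding a b by (rule sym)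
    then show ?thesis using True by simp
  next
    case False
    then obtain j where j: "j \<in> K" "c j \<noteq> d j" using cfgs_eqI assms by metis
    then have "joinc a c j \<noteq> joinc b d j" using aK by (simp add: joinc_def)
    then show ?thesis using trivial_eq_0[OF X ac bd] j False by simp
  qed
qed

lemma tr_eq: "tr {..<n} X = 2 ^ card K * tr \<Lambda> X"
proof -
  have "tr {..<n} X = (\<Sum>a\<in>cfgs \<Lambda>. \<Sum>c\<in>cfgs K. X a a)"
    unfolding tr_def sum_split by (intro sum.cong refl) (simp add: kernel_joinc)
  then show ?thesis by (simp add: tr_def card_cfgs fin sum_distrib_left)
qed

text \<open>The Kronecker delta on \<open>K\<close> in the kernel of \<open>X\<close> identifies the
  two environment indices, and the sum that remains is the partial trace.\<close>

lemma tr_proj_eq: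
  "tr {..<n} (mmult {..<n} (proj \<psi>) X) = tr \<Lambda> (mmult \<Lambda> (reduced_state n \<Lambda> \<psi>) X)"
proof -
  have "tr {..<n} (mmult {..<n} (proj \<psi>) X)
      = (\<Sum>a\<in>cfgs \<Lambda>. \<Sum>c\<in>cfgs K. \<Sum>b\<in>cfgs \<Lambda>. \<Sum>d\<in>cfgs K.
          proj \<psi> (joinc a c) (joinc b d) * X (joinc b d) (joinc a c))"
    unfolding tr_def mmult_def sum_split ..
  also have "\<dots> = (\<Sum>a\<in>cfgs \<Lambda>. \<Sum>c\<in>cfgs K. \<Sum>b\<in>cfgs \<Lambda>. proj \<psi> (joinc a c) (joinc b c) * X b a)"
  proof (intro sum.cong refl)
    fix a c b assume acb: "a \<in> cfgs \<Lambda>" "c \<in> cfgs K" "b \<in> cfgs \<Lambda>"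
    have "(\<Sum>d\<in>cfgs K. proj \<psi> (joinc a c) (joinc b d) * X (joinc b d) (joinc a c))
        = (\<Sum>d\<in>cfgs K. if d = c then proj \<psi> (joinc a c) (joinc b d) * X b a else 0)"
      by (rule sum.cong) (use acb in \<open>auto simp: kernel_joinc\<close>)
    then show "(\<Sum>d\<in>cfgs K. proj \<psi> (joinc a c) (joinc b d) * X (joinc b d) (joinc a c))
        = proj \<psi> (joinc a c) (joinc b c) * X b a"
      using acb by (simp add: finite_cfgs fin)
  qed
  also have "\<dots> = (\<Sum>a\<in>cfgs \<Lambda>. \<Sum>b\<in>cfgs \<Lambda>. \<Sum>c\<in>cfgs K. proj \<psi> (joinc a c) (joinc b c) * X b a)"
    by (rule sum.cong[OF refl], rule sum.swap)
  also have "\<dots> = tr \<Lambda> (mmult \<Lambda> (reduced_state n \<Lambda> \<psi>) X)"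
    unfolding tr_def mmult_def
    by (intro sum.cong refl) (simp add: reduced_state_def K sum_distrib_right)
  finally show ?thesis .
qed

lemma isometry_restrict:
  assumes U: "opeq {..<n} (mmult {..<n} (adj X) X) (ident {..<n})"
    and ab: "a \<in> cfgs \<Lambda>" "b \<in> cfgs \<Lambda>"
  shows "mmult \<Lambda> (adj X) X a b = ident \<Lambda> a b"
proof -
  let ?o = "\<lambda>_::nat. False"
  have o: "?o \<in> cfgs K" by (simp add: cfgs_def)
  have j: "joinc a ?o = a" "joinc b ?o = b" by (simp_all add: joinc_def)
  have N: "a \<in> cfgs {..<n}" "b \<in> cfgs {..<n}" using ab cfgs_mono[OF \<Lambda>] by auto
  have "ident \<Lambda> a b = ident {..<n} a b" using ab N by (simp add: ident_def)
  also have "\<dots> = mmult {..<n} (adj X) X a b" using U N by (simp add: opeq_def)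
  also have "\<dots> = (\<Sum>e\<in>cfgs \<Lambda>. \<Sum>d\<in>cfgs K. cnj (X (joinc e d) a) * X (joinc e d) b)"
    unfolding mmult_def adj_def sum_split ..
  also have "\<dots> = (\<Sum>e\<in>cfgs \<Lambda>. \<Sum>d\<in>cfgs K. if d = ?o then cnj (X e a) * X e b else 0)"
  proof (intro sum.cong refl)
    fix e d assume "e \<in> cfgs \<Lambda>" "d \<in> cfgs K"
    then show "cnj (X (joinc e d) a) * X (joinc e d) b = (if d = ?o then cnj (X e a) * X e b else 0)"
      using kernel_joinc[of e a d ?o] kernel_joinc[of e b d ?o] ab o by (simp add: j)
  qed
  also have "\<dots> = mmult \<Lambda> (adj X) X a b"
    using o by (simp add: mmult_def adj_def finite_cfgs fin)
  finally show ?thesis by simp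
qed

lemma proj_tr_deviation:
  assumes U: "opeq {..<n} (mmult {..<n} (adj X) X) (ident {..<n})"
  shows "cmod (tr {..<n} (mmult {..<n} (proj \<psi>) X) - tr {..<n} X / 2 ^ n) \<le> info n \<Lambda> \<psi>"
proof -
  let ?A = "\<lambda>a b. reduced_state n \<Lambda> \<psi> a b - ident \<Lambda> a b / 2 ^ card \<Lambda>"
  \<comment> \<open>The trace over \<open>K\<close> contributes \<open>2 ^ card K\<close>, so the
    normalized trace of \<open>X\<close> is the same on \<Lambda> as on the whole chain.\<close>
  have "card \<Lambda> + card K = n"
    using card_Un_disjoint[OF fin disj] by (simp add: union)
  then have "tr {..<n} X / 2 ^ n = tr \<Lambda> X / 2 ^ card \<Lambda>"
    unfolding tr_eq by (auto simp: power_add)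
  also have "tr \<Lambda> X = tr \<Lambda> (mmult \<Lambda> (ident \<Lambda>) X)"
    by (rule tr_opeq, rule opeq_sym, rule opeq_ident_mmult[OF fin(1)])
  finally have "tr {..<n} (mmult {..<n} (proj \<psi>) X) - tr {..<n} X / 2 ^ n
      = tr \<Lambda> (mmult \<Lambda> (reduced_state n \<Lambda> \<psi>) X) - tr \<Lambda> (mmult \<Lambda> (ident \<Lambda>) X) / 2 ^ card \<Lambda>"
    by (simp add: tr_proj_eq)
  also have "\<dots> = tr \<Lambda> (mmult \<Lambda> ?A X)"
    by (simp add: tr_def mmult_def left_diff_distrib sum_subtractf sum_divide_distrib)
  also have "cmod \<dots> \<le> trace_norm \<Lambda> ?A"
  proof (rule cmod_tr_mmult_le_trace_norm[OF fin(1) _ _ isometry_restrict[OF U]])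
    show "supported_on \<Lambda> ?A"
      by (auto simp: supported_on_def reduced_state_def ident_def split: if_splits)
    show "?A a b = cnj (?A b a)" for a b
      by (auto simp: reduced_state_def ident_def proj_def mult.commute)
  qed
  finally show ?thesis by (simp add: info_def)
qed

end

lemma tr_deviation_le_info:
  assumes U: "opeq {..<n} (mmult {..<n} (adj X) X) (ident {..<n})"
  shows "cmod (tr {..<n} (mmult {..<n} (proj \<psi>) X) - tr {..<n} X / 2 ^ n) \<le> info n (supp n X) \<psi>"
proof -
  interpret trivial_outside n "supp n X" "{..<n} - supp n X" X
    by unfold_locales (auto simp: supp_def)
  show ?thesis using U by (rule proj_tr_deviation)
qed

section \<open>Pauli coefficients\<close>

lemma vnorm_applyv_le_op_norm:
  assumes fin: "finite (cfgs S)" and v: "vnorm S v \<le> 1"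
  shows "vnorm S (applyv S A v) \<le> op_norm S A"
  unfolding op_norm_def
proof (rule cSUP_upper)
  show "v \<in> {v. vnorm S v \<le> 1}" using v by simp
  \<comment> \<open>The supremum is an upper bound only for a bounded set. Entries of vectors in the
    unit ball have modulus at most 1, so crude row sums bound the image.\<close>
  show "bdd_above ((\<lambda>v. vnorm S (applyv S A v)) ` {v. vnorm S v \<le> 1})"
  proof (rule bdd_aboveI2)
    fix w assume "w \<in> {v. vnorm S v \<le> 1}"
    then have w: "(\<Sum>a\<in>cfgs S. (cmod (w a))\<^sup>2) \<le> 1" by (simp add: vnorm_def)
    have w1: "cmod (w b) \<le> 1" if "b \<in> cfgs S" for b
    proof -
      have "(cmod (w b))\<^sup>2 \<le> (\<Sum>a\<in>cfgs S. (cmod (w a))\<^sup>2)"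
        by (rule member_le_sum) (use that fin in auto)
      then have "(cmod (w b))\<^sup>2 \<le> 1\<^sup>2" using w by simp
      then show ?thesis by (rule power2_le_imp_le) simp
    qed
    have "cmod (applyv S A w a) \<le> (\<Sum>b\<in>cfgs S. cmod (A a b))" for a
      unfolding applyv_def
      by (rule sum_norm_le) (use w1 in \<open>auto simp: norm_mult intro: mult_left_le\<close>)
    then show "vnorm S (applyv S A w) \<le> sqrt (\<Sum>a\<in>cfgs S. (\<Sum>b\<in>cfgs S. cmod (A a b))\<^sup>2)"
      unfolding vnorm_def by (intro real_sqrt_le_mono sum_mono power_mono) auto
  qed
qed

lemma op_norm_nonneg: "finite (cfgs S) \<Longrightarrow> 0 \<le> op_norm S A"
  using vnorm_applyv_le_op_norm[of S "\<lambda>_. 0" A] by (simp add: vnorm_def applyv_def)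

text \<open>A column is the image of a basis vector, which has norm 1.\<close>

lemma column_le_op_norm:
  assumes fin: "finite (cfgs S)" and b: "b \<in> cfgs S"
  shows "(\<Sum>a\<in>cfgs S. (cmod (A a b))\<^sup>2) \<le> (op_norm S A)\<^sup>2"
proof -
  let ?e = "\<lambda>a. if a = b then 1 else 0"
  have "(\<Sum>a\<in>cfgs S. (cmod (?e a))\<^sup>2) = (\<Sum>a\<in>cfgs S. if a = b then 1 else 0)"
    by (rule sum.cong) auto
  then have "vnorm S ?e \<le> 1" using fin b by (simp add: vnorm_def)
  then have "vnorm S (applyv S A ?e) \<le> op_norm S A" by (rule vnorm_applyv_le_op_norm[OF fin])
  moreover have "applyv S A ?e a = A a b" for a
    using fin b by (simp add: applyv_def if_distrib cong: if_cong)
  ultimately have "sqrt (\<Sum>a\<in>cfgs S. (cmod (A a b))\<^sup>2) \<le> op_norm S A" by (simp add: vnorm_def)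
  then show ?thesis by (rule sqrt_le_D)
qed

lemma frobenius_le_op_norm:
  assumes fin: "finite (cfgs S)"
  shows "(\<Sum>a\<in>cfgs S. \<Sum>b\<in>cfgs S. (cmod (A a b))\<^sup>2) \<le> card (cfgs S) * (op_norm S A)\<^sup>2"
  by (subst sum.swap, rule sum_bounded_above[THEN order_trans]) (use column_le_op_norm[OF fin] in auto)

text \<open>Parseval's identity: after expanding the square, orthogonality removes the cross terms,
  because injectivity of \<open>p\<close> makes distinct indices distinct strings.\<close>

lemma pauli_coefficients:
  assumes "finite I" and lab: "\<And>i. i \<in> I \<Longrightarrow> is_pauli_label n (p i)" and inj: "inj_on p I"
  shows "(\<Sum>a\<in>cfgs {..<n}. \<Sum>b\<in>cfgs {..<n}.
      (cmod (\<Sum>i\<in>I. of_real (c i) * pauli_string n (p i) a b))\<^sup>2) = 2 ^ n * (\<Sum>i\<in>I. (c i)\<^sup>2)"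
proof -
  let ?K = "cfgs {..<n}" and ?P = "\<lambda>i. pauli_string n (p i)"
  let ?O = "\<lambda>a b. \<Sum>i\<in>I. of_real (c i) * ?P i a b"
  have "complex_of_real (\<Sum>a\<in>?K. \<Sum>b\<in>?K. (cmod (?O a b))\<^sup>2)
      = (\<Sum>a\<in>?K. \<Sum>b\<in>?K. ?O a b * cnj (?O a b))"
    by (simp only: of_real_sum complex_norm_square)
  also have "\<dots> = (\<Sum>a\<in>?K. \<Sum>b\<in>?K. \<Sum>i\<in>I. \<Sum>j\<in>I. of_real (c i * c j) * (?P i a b * cnj (?P j a b)))"
    by (simp add: sum_product mult_ac)
  also have "\<dots> = (\<Sum>a\<in>?K. \<Sum>i\<in>I. \<Sum>b\<in>?K. \<Sum>j\<in>I. of_real (c i * c j) * (?P i a b * cnj (?P j a b)))"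
    by (rule sum.cong[OF refl], rule sum.swap)
  also have "\<dots> = (\<Sum>i\<in>I. \<Sum>a\<in>?K. \<Sum>b\<in>?K. \<Sum>j\<in>I. of_real (c i * c j) * (?P i a b * cnj (?P j a b)))"
    by (rule sum.swap)
  also have "\<dots> = (\<Sum>i\<in>I. \<Sum>a\<in>?K. \<Sum>j\<in>I. \<Sum>b\<in>?K. of_real (c i * c j) * (?P i a b * cnj (?P j a b)))"
    by (rule sum.cong[OF refl], rule sum.cong[OF refl], rule sum.swap)
  also have "\<dots> = (\<Sum>i\<in>I. \<Sum>j\<in>I. \<Sum>a\<in>?K. \<Sum>b\<in>?K. of_real (c i * c j) * (?P i a b * cnj (?P j a b)))"
    by (rule sum.cong[OF refl], rule sum.swap)
  also have "\<dots> = (\<Sum>i\<in>I. \<Sum>j\<in>I. of_real (c i * c j) * (\<Sum>a\<in>?K. \<Sum>b\<in>?K. ?P i a b * cnj (?P j a b)))"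
    by (simp only: sum_distrib_left)
  also have "\<dots> = (\<Sum>i\<in>I. \<Sum>j\<in>I. if i = j then of_real (2 ^ n * (c i)\<^sup>2) else 0)"
  proof (intro sum.cong refl)
    fix i j assume ij: "i \<in> I" "j \<in> I"
    then have "p i = p j \<longleftrightarrow> i = j" using inj by (auto dest: inj_onD)
    then show "of_real (c i * c j) * (\<Sum>a\<in>?K. \<Sum>b\<in>?K. ?P i a b * cnj (?P j a b))
        = (if i = j then of_real (2 ^ n * (c i)\<^sup>2) else 0)"
      by (simp add: pauli_string_orthogonal[OF lab lab] ij power2_eq_square)
  qed
  also have "\<dots> = of_real (2 ^ n * (\<Sum>i\<in>I. (c i)\<^sup>2))"
    using assms(1) by (simp add: sum_distrib_left)
  finally show ?thesis by (simp only: of_real_eq_iff)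
qed

text \<open>A label is encoded as the list of its nontrivial entries, padded with \<open>(n, 0)\<close>.\<close>

lemma pauli_labels_subset_lists:
  assumes lab: "is_pauli_label n p" and k: "card {j. j < n \<and> p j \<noteq> 0} \<le> k"
  defines "\<Sigma> \<equiv> insert (n, 0) ({..<n} \<times> {1..3})"
  shows "p \<in> (\<lambda>xs j. case map_of xs j of None \<Rightarrow> 0 | Some v \<Rightarrow> v) ` {xs. set xs \<subseteq> \<Sigma> \<and> length xs = k}"
proof -
  obtain js where js: "set js = {j. j < n \<and> p j \<noteq> 0}" "distinct js"
    using finite_distinct_list[of "{j. j < n \<and> p j \<noteq> 0}"] by auto
  have len: "length js \<le> k" using k distinct_card[OF js(2)] js(1) by simp
  \<comment> \<open>A padding entry decodes to 0, and it sits at position \<open>n\<close>, where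
    every label is 0 anyway.\<close>
  define xs where "xs = map (\<lambda>j. (j, p j)) js @ replicate (k - length js) (n, 0)"
  have rep: "map_of (replicate m (n, 0::nat)) j \<noteq> Some v" if "v \<noteq> 0" for m j v
    using that by (auto dest!: map_of_SomeD)
  have "p = (\<lambda>j. case map_of xs j of None \<Rightarrow> 0 | Some v \<Rightarrow> v)"
  proof
    fix j
    show "p j = (case map_of xs j of None \<Rightarrow> 0 | Some v \<Rightarrow> v)"
    proof (cases "j \<in> set js")
      case True
      then show ?thesis using rep
        by (auto simp: xs_def map_of_map_restrict restrict_map_def map_add_def split: option.split)
    next
      case False
      then have "p j = 0" using js lab by (auto simp: is_pauli_label_def not_less)
      moreover have "map_of xs j = map_of (replicate (k - length js) (n, 0)) j" using False
        by (auto simp: xs_def map_of_map_restrict restrict_map_def map_add_def split: option.split)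
      ultimately show ?thesis using rep[of _ "k - length js" j] by (auto split: option.split)
    qed
  qed
  moreover have "length xs = k" using len by (simp add: xs_def)
  moreover have "set xs \<subseteq> \<Sigma>"
  proof -
    have "p j < 4" for j using lab by (simp add: is_pauli_label_def)
    then have "p j \<le> 3" for j using less_Suc_eq_le[of "p j" 3] by simp
    then show ?thesis using js by (auto simp: xs_def \<Sigma>_def)
  qed
  ultimately show ?thesis by blast
qed

text \<open>The base counts the letters of the encoding: three nontrivial Paulis at each of
  \<open>n\<close> sites, plus the padding.\<close>

lemma card_pauli_labels:
  assumes "\<And>i. i \<in> I \<Longrightarrow> is_pauli_label n (p i)" "inj_on p I"
    and "\<And>i. i \<in> I \<Longrightarrow> card {j. j < n \<and> p i j \<noteq> 0} \<le> k"
  shows "card I \<le> (3 * n + 1) ^ k"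
proof -
  let ?S = "insert (n, 0::nat) ({..<n} \<times> {1..3})"
  let ?L = "{xs. set xs \<subseteq> ?S \<and> length xs = k}"
  have fin: "finite ?L" by (rule finite_lists_length_eq) simp
  have "card I = card (p ` I)" using assms(2) by (simp add: card_image)
  also have "\<dots> \<le> card ((\<lambda>xs j. case map_of xs j of None \<Rightarrow> 0 | Some v \<Rightarrow> v) ` ?L)"
    by (rule card_mono) (use fin pauli_labels_subset_lists assms in blast)+
  also have "\<dots> \<le> card ?L" by (rule card_image_le[OF fin])
  also have "\<dots> = card ?S ^ k" by (rule card_lists_length_eq) simp
  also have "card ?S = 3 * n + 1" by simp
  finally show ?thesis .
qed

text \<open>Bounding each \<open>|c\<^sub>i|\<close> by \<open>\<parallel>O\<parallel>\<close> would only give the number of strings as a factor,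
  which is \<open>3n + 1 > 3n\<close> already for \<open>k = 1\<close>; Cauchy-Schwarz leaves room through its square root.\<close>

lemma sum_abs_pauli_coefficients:
  assumes "finite I" and lab: "\<And>i. i \<in> I \<Longrightarrow> is_pauli_label n (p i)" and inj: "inj_on p I"
    and k: "\<And>i. i \<in> I \<Longrightarrow> card {j. j < n \<and> p i j \<noteq> 0} \<le> k" and n0: "n = 0 \<Longrightarrow> k = 0"
  shows "(\<Sum>i\<in>I. \<bar>c i\<bar>) \<le> (3 * real n) ^ k *
    op_norm {..<n} (\<lambda>a b. \<Sum>i\<in>I. of_real (c i) * pauli_string n (p i) a b)"
    (is "_ \<le> _ * op_norm _ ?O")
proof (rule power2_le_imp_le)
  have fin: "finite (cfgs {..<n})" by (simp add: finite_cfgs)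
  show "0 \<le> (3 * real n) ^ k * op_norm {..<n} ?O" using op_norm_nonneg[OF fin] by simp
  have "2 ^ n * (\<Sum>i\<in>I. (c i)\<^sup>2) \<le> 2 ^ n * (op_norm {..<n} ?O)\<^sup>2"
    using frobenius_le_op_norm[OF fin, of ?O] pauli_coefficients[OF assms(1-3), of c]
    by (simp add: card_cfgs)
  then have sq: "(\<Sum>i\<in>I. (c i)\<^sup>2) \<le> (op_norm {..<n} ?O)\<^sup>2" by simp
  have "real (card I) \<le> real ((3 * n + 1) ^ k)"
    using card_pauli_labels[OF lab inj k] by (simp only: of_nat_le_iff)
  \<comment> \<open>For \<open>n \<ge> 1\<close> the padding letter is absorbed by
    \<open>3 n + 1 \<le> (3 n)\<^sup>2\<close>; for \<open>n = 0\<close> the exponent is 0 and both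
    sides are 1.\<close>
  also have "\<dots> \<le> ((3 * real n) ^ k)\<^sup>2"
  proof (cases "n = 0")
    case False
    then have "1 \<le> real n" by simp
    then have "3 * real n + 1 \<le> 3 * real n * (3 * real n)"
      using mult_left_mono[of 1 "real n" "real n"] by linarith
    then have "(3 * real n + 1) ^ k \<le> (3 * real n * (3 * real n)) ^ k" by (rule power_mono) simp
    also have "(3 * real n * (3 * real n)) ^ k = ((3 * real n) ^ k)\<^sup>2"
      by (simp only: power_mult_distrib power2_eq_square)
    finally show ?thesis by (simp only: of_nat_power of_nat_add of_nat_mult of_nat_numeral of_nat_1)
  qed (simp add: n0)
  finally have card: "real (card I) \<le> ((3 * real n) ^ k)\<^sup>2" .
  have "(\<Sum>i\<in>I. \<bar>c i\<bar>)\<^sup>2 \<le> (\<Sum>i\<in>I. (c i)\<^sup>2) * card I"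
    using sum_squared_le_sum_of_squares[of "\<lambda>i. \<bar>c i\<bar>" I] by simp
  also have "\<dots> \<le> (op_norm {..<n} ?O)\<^sup>2 * ((3 * real n) ^ k)\<^sup>2"
    by (rule mult_mono[OF sq card]) auto
  finally show "(\<Sum>i\<in>I. \<bar>c i\<bar>)\<^sup>2 \<le> ((3 * real n) ^ k * op_norm {..<n} ?O)\<^sup>2"
    by (simp add: power_mult_distrib mult.commute)
qed

section \<open>Traces in the Heisenberg picture and the assembly of the bounds\<close>

lemma tr_mmult_sum:
  "tr S (mmult S A (\<lambda>a b. \<Sum>i\<in>I. x i * B i a b)) = (\<Sum>i\<in>I. x i * tr S (mmult S A (B i)))"
proof -
  have "tr S (mmult S A (\<lambda>a b. \<Sum>i\<in>I. x i * B i a b))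
      = (\<Sum>a\<in>cfgs S. \<Sum>b\<in>cfgs S. \<Sum>i\<in>I. x i * (A a b * B i b a))"
    by (simp add: tr_def mmult_def sum_distrib_left mult_ac)
  also have "\<dots> = (\<Sum>a\<in>cfgs S. \<Sum>i\<in>I. \<Sum>b\<in>cfgs S. x i * (A a b * B i b a))"
    by (rule sum.cong[OF refl], rule sum.swap)
  also have "\<dots> = (\<Sum>i\<in>I. \<Sum>a\<in>cfgs S. \<Sum>b\<in>cfgs S. x i * (A a b * B i b a))"
    by (rule sum.swap)
  finally show ?thesis by (simp add: tr_def mmult_def sum_distrib_left)
qed

lemma tr_sum: "tr S (\<lambda>a b. \<Sum>i\<in>I. x i * B i a b) = (\<Sum>i\<in>I. x i * tr S (B i))"
  unfolding tr_def sum_distrib_left by (rule sum.swap)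

lemma tr_evolved_state:
  "tr {..<n} (mmult {..<n} (mmult {..<n} (mmult {..<n} U \<rho>) (adj U)) P)
    = tr {..<n} (mmult {..<n} \<rho> (conjugate n U P))"
  using tr_mmult_commute[of "{..<n}" U] by (simp add: mmult_assoc)

lemma tr_conjugate:
  assumes "is_unitary {..<n} U"
  shows "tr {..<n} (conjugate n U P) = tr {..<n} P"
proof -
  have "tr {..<n} (conjugate n U P) = tr {..<n} (mmult {..<n} P (mmult {..<n} U (adj U)))"
    using tr_mmult_commute[of "{..<n}" "adj U"] by (simp add: mmult_assoc)
  also have "\<dots> = tr {..<n} (mmult {..<n} P (ident {..<n}))"
    using assms by (intro tr_opeq opeq_mmult opeq_refl) (simp add: is_unitary_iff)
  also have "\<dots> = tr {..<n} P" by (intro tr_opeq opeq_mmult_ident) simp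
  finally show ?thesis .
qed

lemma is_unitary_adj: "is_unitary S U \<Longrightarrow> is_unitary S (adj U)"
  by (simp add: is_unitary_iff adj_adj)

theorem theorem1:
  fixes n D s :: nat and \<theta> :: "nat \<Rightarrow> nat \<Rightarrow> real" and H V :: "nat \<Rightarrow> nat \<Rightarrow> qop"
    and \<psi> :: qvec and I :: "'i set" and c :: "'i \<Rightarrow> real" and p :: "'i \<Rightarrow> nat \<Rightarrow> nat"
  assumes "D \<ge> 1"
    and "valid_hea n D s H V"
    and "vnorm {..<n} \<psi> = 1"
    and "finite I" and "I \<noteq> {}"
    and "\<forall>i\<in>I. is_pauli_label n (p i)"
    and "inj_on p I"
  shows
   "let N = {..<n};
        U = hea_unitary n \<theta> H V s D;
        P = (\<lambda>i. pauli_string n (p i));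
        Obs = (\<lambda>a b. \<Sum>i\<in>I. of_real (c i) * P i a b);
        f = tr N (mmult N (mmult N (mmult N U (proj \<psi>)) (adj U)) Obs);
        ftrv = tr N Obs / 2 ^ n;
        \<Lambda> = (\<lambda>i. supp n (mmult N (mmult N (adj U) (P i)) U));
        k = Max ((\<lambda>i. card (supp n (P i))) ` I)
    in cmod (f - ftrv) \<le> (\<Sum>i\<in>I. \<bar>c i\<bar> * info n (\<Lambda> i) \<psi>)
       \<and> (\<Sum>i\<in>I. \<bar>c i\<bar>) \<le> (3 * real n) ^ k * op_norm N Obs
       \<and> (\<forall>i\<in>I. card (\<Lambda> i) \<le> 2 * D * k)"
proof -
  let ?N = "{..<n}"
  define U where "U = hea_unitary n \<theta> H V s D"
  let ?P = "\<lambda>i. pauli_string n (p i)"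
  let ?X = "\<lambda>i. conjugate n U (?P i)"
  define k where "k = Max ((\<lambda>i. card (supp n (?P i))) ` I)"
  let ?O = "\<lambda>a b. \<Sum>i\<in>I. of_real (c i) * ?P i a b"
  have gates: "local_gate n j (hea_gate n \<theta> H V l j)" if "l < D" "j \<in> set (hea_pairs n s l)" for l j
    using local_gate_hea[OF assms(2) that] .
  have U: "is_unitary ?N U" unfolding U_def by (rule unitary_hea[OF gates])
  have k: "card (supp n (?P i)) \<le> k" if "i \<in> I" for i
    unfolding k_def using assms(4) that by (intro Max_ge) auto
  \<comment> \<open>The evolved string is a product of unitaries, which provides the isometry that
    duality asks for.\<close>
  have XX: "opeq ?N (mmult ?N (adj (?X i)) (?X i)) (ident ?N)" for i
  proof -
    have "is_unitary ?N (?X i)"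
      by (intro is_unitary_mmult is_unitary_adj is_unitary_pauli_string U) simp_all
    then show ?thesis by (simp add: is_unitary_iff)
  qed
  \<comment> \<open>Conjugation by \<open>U\<close> preserves the trace, so the trivial value of
    each term can be expressed by the same operator as its expectation.\<close>
  have split: "tr ?N (mmult ?N (mmult ?N (mmult ?N U (proj \<psi>)) (adj U)) ?O) - tr ?N ?O / 2 ^ n
      = (\<Sum>i\<in>I. of_real (c i) * (tr ?N (mmult ?N (proj \<psi>) (?X i)) - tr ?N (?X i) / 2 ^ n))"
    unfolding tr_mmult_sum tr_sum tr_evolved_state tr_conjugate[OF U]
    by (simp add: sum_divide_distrib sum_subtractf right_diff_distrib)
  have bound: "cmod (tr ?N (mmult ?N (mmult ?N (mmult ?N U (proj \<psi>)) (adj U)) ?O) - tr ?N ?O / 2 ^ n)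
    \<le> (\<Sum>i\<in>I. \<bar>c i\<bar> * info n (supp n (?X i)) \<psi>)"
    unfolding split
    by (rule sum_norm_le) (simp add: norm_mult mult_left_mono tr_deviation_le_info[OF XX])
  have coeff: "(\<Sum>i\<in>I. \<bar>c i\<bar>) \<le> (3 * real n) ^ k * op_norm ?N ?O"
  proof (rule sum_abs_pauli_coefficients)
    show "card {j. j < n \<and> p i j \<noteq> 0} \<le> k" if "i \<in> I" for i
      by (rule order_trans[OF card_mono[OF _ supp_pauli_string] k[OF that]]) (simp add: supp_def)
    \<comment> \<open>Without qubits all supports are empty, and \<open>I \<noteq> {}\<close> makes
      the maximum range over exactly \<open>{0}\<close>.\<close>
    show "k = 0" if "n = 0"
    proof -
      have "(\<lambda>i. card (supp n (?P i))) ` I = {0}" using that assms(5) by (auto simp: supp_def)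
      then show ?thesis by (simp add: k_def)
    qed
  qed (use assms in auto)
  have "card (supp n (?X i)) \<le> 2 * D * k" if "i \<in> I" for i
    unfolding U_def
    by (rule order_trans[OF light_cone[OF gates assms(1)]]) (use k[OF that] in auto)
  \<comment> \<open>Associativity reconciles the bracketing of the evolved operator in the statement
    with that of \<open>conjugate\<close>.\<close>
  with bound coeff show ?thesis
    unfolding Let_def U_def[symmetric] k_def[symmetric] mmult_assoc[of _ "adj U"] by blast
qed

end
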